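(* Let $H$ be a finite dimensional Frobenius weak Hopf algebra over a field $k$ such that $S^2|_{H_{\min}}=\mathrm{id}$. There is a canonically defined coset $\tilde\alpha\in\widetilde G(H^* )=G(H^* )/G_0(H^* )$ (depending only on $H$) such that for every non-degenerate left integral $\ell\in\int_H^l$ and every representative $\alpha\in G(H^* )$ of $\tilde\alpha$ one has an isomorphism $W_\ell\cong H_s^\alpha$ of right $H$-modules.
   Context: A weak Hopf algebra over a field $k$ is a $k$-vector space $H$ with an associative unital algebra structure $(m,1)$, a coassociative counital coalgebra structure $(\Delta,\epsilon)$ (Sweedler notation $\Delta(h)=h_{(1)}\otimes h_{(2)}$) and a linear map $S:H\to H$ (antipode) such that for all $f,g,h\in H$: $\Delta(hg)=\Delta(h)\Delta(g)$; $(\Delta\otimes\mathrm{id})\Delta(1)=(\Delta(1)\otimes1)(1\otimes\Delta(1))=(1\otimes\Delta(1))(\Delta(1)\otimes1)$; $\epsilon(fgh)=\epsilon(fg_{(1)})\epsilon(g_{(2)}h)=\epsilon(fg_{(2)})\epsilon(g_{(1)}h)$; $m(\mathrm{id}\otimes S)\Delta(h)=(\epsilon\otimes\mathrm{id})(\Delta(1)(h\otimes1))$; $m(S\otimes\mathrm{id})\Delta(h)=(\mathrm{id}\otimes\epsilon)((1\otimes h)\Delta(1))$; $S(h)=S(h_{(1)})h_{(2)}S(h_{(3)})$. ($\Delta(1)\neq1\otimes1$ in general.) Counital maps: $\varepsilon_t(h)=\epsilon(1_{(1)}h)1_{(2)}$, $\varepsilon_s(h)=1_{(1)}\epsilon(h1_{(2)})$;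 bases $H_t=\varepsilon_t(H)$, $H_s=\varepsilon_s(H)$ (commuting separable subalgebras); $H_{\min}=H_tH_s$. If $\dim_kH<\infty$, $H^*$ is a weak Hopf algebra via $\langle\phi\psi,h\rangle=\langle\phi\otimes\psi,\Delta(h)\rangle$, $\langle\Delta(\phi),h\otimes g\rangle=\langle\phi,hg\rangle$, $\langle S(\phi),h\rangle=\langle\phi,S(h)\rangle$, with unit $\epsilon$ and counit $\phi\mapsto\langle\phi,1\rangle$; its source base is denoted $H_s^*$. A left integral is $\ell\in H$ with $h\ell=\varepsilon_t(h)\ell$ for all $h\in H$; the space of these is $\int_H^l$. An integral is non-degenerate if it defines a non-degenerate functional on $H^*$. $H$ is Frobenius (as an algebra) if and only if it has a non-degenerate integral. Group-like elements: invertible $g$ with $\Delta(g)=(g\otimes g)\Delta(1)=\Delta(1)(g\otimes g)$; they form the group $G(\cdot)$. $G_0(H^* )$ is the normal subgroup of $G(H^* )$ of trivial group-like elements, i.e. those of the form $S(\xi)\xi^{-1}$, $\xi\in H_s^*$ invertible. For $\gamma\in G(H^* )$, $H_s^\gamma$ denotes the space $H_s$ with right $H$-action $y\cdot h=\langle\gamma,yh1_{(1)}\rangle S(1_{(2)})$. For a non-degenerate $\ell\in\int_H^l$, every element of $\int_H^l$ is $\ell y$ for a unique $y\in H_s$, and $W_\ell$ denotes the space $H_s$ with the right $H$-action determined by $\ell yh=\ell(y\cdot h)$, $y\in H_s$, $h\in H$. *)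

theory Defs
  imports Complex_Main "HOL-Algebra.Coset"
begin

section \<open>Tensors\<close>

text \<open>
  An element of \<open>V \<otimes> W\<close> is represented by a formal sum of pure tensors, i.e. by a list of pairs;
  \<open>(a, b)\<close> stands for \<open>a \<otimes> b\<close>, and Sweedler notation becomes list comprehension.
  Two formal sums denote the same tensor iff they cannot be distinguished by bilinear maps;
  over a field, bilinear maps into the field suffice for this.
\<close>

definition bilinear_form :: "('k::field \<Rightarrow> 'h::ab_group_add \<Rightarrow> 'h) \<Rightarrow> ('h \<Rightarrow> 'h \<Rightarrow> 'k) \<Rightarrow> bool" where
  "bilinear_form s B \<longleftrightarrow>
     (\<forall>a. Vector_Spaces.linear s (*) (\<lambda>x. B a x)) \<and>
     (\<forall>b. Vector_Spaces.linear s (*) (\<lambda>x. B x b))"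

definition trilinear_form :: "('k::field \<Rightarrow> 'h::ab_group_add \<Rightarrow> 'h) \<Rightarrow> ('h \<Rightarrow> 'h \<Rightarrow> 'h \<Rightarrow> 'k) \<Rightarrow> bool" where
  "trilinear_form s T \<longleftrightarrow>
     (\<forall>b c. Vector_Spaces.linear s (*) (\<lambda>x. T x b c)) \<and>
     (\<forall>a c. Vector_Spaces.linear s (*) (\<lambda>x. T a x c)) \<and>
     (\<forall>a b. Vector_Spaces.linear s (*) (\<lambda>x. T a b x))"

definition tensor2_eq ::
  "('k::field \<Rightarrow> 'h::ab_group_add \<Rightarrow> 'h) \<Rightarrow> ('h \<times> 'h) list \<Rightarrow> ('h \<times> 'h) list \<Rightarrow> bool" where
  "tensor2_eq s t u \<longleftrightarrow>
     (\<forall>B. bilinear_form s B \<longrightarrow> (\<Sum>(a, b)\<leftarrow>t. B a b) = (\<Sum>(a, b)\<leftarrow>u. B a b))"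

definition tensor3_eq ::
  "('k::field \<Rightarrow> 'h::ab_group_add \<Rightarrow> 'h) \<Rightarrow> ('h \<times> 'h \<times> 'h) list \<Rightarrow> ('h \<times> 'h \<times> 'h) list \<Rightarrow> bool" where
  "tensor3_eq s t u \<longleftrightarrow>
     (\<forall>T. trilinear_form s T \<longrightarrow> (\<Sum>(a, b, c)\<leftarrow>t. T a b c) = (\<Sum>(a, b, c)\<leftarrow>u. T a b c))"


section \<open>Weak Hopf algebras\<close>

text \<open>
  The associative multiplication is the one of the type class; the unit is a separate component,
  so that the zero algebra is not excluded. \<open>comult H h\<close> is a formal sum representing \<open>\<Delta>(h)\<close>.
\<close>

record ('k, 'h) weak_hopf =
  scal :: "'k \<Rightarrow> 'h \<Rightarrow> 'h"
  unit :: "'h"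
  comult :: "'h \<Rightarrow> ('h \<times> 'h) list"
  counit :: "'h \<Rightarrow> 'k"
  antipode :: "'h \<Rightarrow> 'h"

definition eps_t :: "('k::field, 'h::ring) weak_hopf \<Rightarrow> 'h \<Rightarrow> 'h" where
  "eps_t H h = (\<Sum>(a, b)\<leftarrow>comult H (unit H). scal H (counit H (a * h)) b)"

definition eps_s :: "('k::field, 'h::ring) weak_hopf \<Rightarrow> 'h \<Rightarrow> 'h" where
  "eps_s H h = (\<Sum>(a, b)\<leftarrow>comult H (unit H). scal H (counit H (h * b)) a)"

locale weak_hopf_algebra =
  fixes H :: "('k::field, 'h::ring) weak_hopf"
  assumes vector_space: "vector_space (scal H)"
    and mult_scal_left: "scal H c x * y = scal H c (x * y)"
    and mult_scal_right: "x * scal H c y = scal H c (x * y)"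
    and unit_left: "unit H * x = x"
    and unit_right: "x * unit H = x"
    and comult_add: "tensor2_eq (scal H) (comult H (x + y)) (comult H x @ comult H y)"
    and comult_scal:
      "tensor2_eq (scal H) (comult H (scal H c x)) [(scal H c a, b). (a, b) \<leftarrow> comult H x]"
    and comult_coassoc:
      "tensor3_eq (scal H)
         [(c, d, b). (a, b) \<leftarrow> comult H h, (c, d) \<leftarrow> comult H a]
         [(a, c, d). (a, b) \<leftarrow> comult H h, (c, d) \<leftarrow> comult H b]"
    and counit_linear: "Vector_Spaces.linear (scal H) (*) (counit H)"
    and counit_left: "(\<Sum>(a, b)\<leftarrow>comult H h. scal H (counit H a) b) = h"
    and counit_right: "(\<Sum>(a, b)\<leftarrow>comult H h. scal H (counit H b) a) = h"
    and antipode_linear: "Vector_Spaces.linear (scal H) (scal H) (antipode H)"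
    and comult_mult:
      "tensor2_eq (scal H) (comult H (h * g))
         [(a * c, b * d). (a, b) \<leftarrow> comult H h, (c, d) \<leftarrow> comult H g]"
    \<comment> \<open>\<open>(a \<otimes> b \<otimes> 1)(1 \<otimes> c \<otimes> d) = a \<otimes> bc \<otimes> d\<close> and \<open>(1 \<otimes> c \<otimes> d)(a \<otimes> b \<otimes> 1) = a \<otimes> cb \<otimes> d\<close>\<close>
    and comult_unit1:
      "tensor3_eq (scal H)
         [(c, d, b). (a, b) \<leftarrow> comult H (unit H), (c, d) \<leftarrow> comult H a]
         [(a, b * c, d). (a, b) \<leftarrow> comult H (unit H), (c, d) \<leftarrow> comult H (unit H)]"
    and comult_unit2:
      "tensor3_eq (scal H)
         [(c, d, b). (a, b) \<leftarrow> comult H (unit H), (c, d) \<leftarrow> comult H a]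
         [(a, c * b, d). (a, b) \<leftarrow> comult H (unit H), (c, d) \<leftarrow> comult H (unit H)]"
    and counit_mult1:
      "counit H (f * g * h) = (\<Sum>(a, b)\<leftarrow>comult H g. counit H (f * a) * counit H (b * h))"
    and counit_mult2:
      "counit H (f * g * h) = (\<Sum>(a, b)\<leftarrow>comult H g. counit H (f * b) * counit H (a * h))"
    and antipode_right: "(\<Sum>(a, b)\<leftarrow>comult H h. a * antipode H b) = eps_t H h"
    and antipode_left: "(\<Sum>(a, b)\<leftarrow>comult H h. antipode H a * b) = eps_s H h"
    and antipode_conv:
      "antipode H h =
         (\<Sum>(a, b)\<leftarrow>comult H h. \<Sum>(c, d)\<leftarrow>comult H a. antipode H c * d * antipode H b)"

definition finite_dimensional :: "('k::field, 'h::ring) weak_hopf \<Rightarrow> bool" where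
  "finite_dimensional H \<longleftrightarrow> (\<exists>B. finite B \<and> module.span (scal H) B = UNIV)"

definition base_t :: "('k::field, 'h::ring) weak_hopf \<Rightarrow> 'h set" where
  "base_t H = range (eps_t H)"

definition base_s :: "('k::field, 'h::ring) weak_hopf \<Rightarrow> 'h set" where
  "base_s H = range (eps_s H)"

definition min_subalgebra :: "('k::field, 'h::ring) weak_hopf \<Rightarrow> 'h set" where
  "min_subalgebra H = module.span (scal H) {x * y | x y. x \<in> base_t H \<and> y \<in> base_s H}"

definition frobenius_algebra :: "('k::field, 'h::ring) weak_hopf \<Rightarrow> bool" where
  "frobenius_algebra H \<longleftrightarrow>
     (\<exists>l. Vector_Spaces.linear (scal H) (*) l \<and>
        (\<forall>x. (\<forall>y. l (x * y) = 0) \<longrightarrow> x = 0) \<and>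
        (\<forall>y. (\<forall>x. l (x * y) = 0) \<longrightarrow> y = 0))"


section \<open>The dual weak Hopf algebra and its group-like elements\<close>

text \<open>
  For finite dimensional \<open>H\<close>, the space \<open>H\<^sup>* \<otimes> H\<^sup>*\<close> is identified, through the pairing with
  \<open>H \<otimes> H\<close>, with the space of bilinear forms on \<open>H\<close>: \<open>\<phi> \<otimes> \<psi>\<close> is \<open>(h, g) \<mapsto> \<phi>(h) \<psi>(g)\<close>.
\<close>

definition dual_space :: "('k::field, 'h::ring) weak_hopf \<Rightarrow> ('h \<Rightarrow> 'k) set" where
  "dual_space H = {\<phi>. Vector_Spaces.linear (scal H) (*) \<phi>}"

definition dual_mult :: "('k::field, 'h::ring) weak_hopf \<Rightarrow> ('h \<Rightarrow> 'k) \<Rightarrow> ('h \<Rightarrow> 'k) \<Rightarrow> 'h \<Rightarrow> 'k" where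
  "dual_mult H \<phi> \<psi> = (\<lambda>h. \<Sum>(a, b)\<leftarrow>comult H h. \<phi> a * \<psi> b)"

definition dual_antipode :: "('k::field, 'h::ring) weak_hopf \<Rightarrow> ('h \<Rightarrow> 'k) \<Rightarrow> 'h \<Rightarrow> 'k" where
  "dual_antipode H \<phi> = (\<lambda>h. \<phi> (antipode H h))"

definition dual_comult :: "('h::ring \<Rightarrow> 'k) \<Rightarrow> 'h \<Rightarrow> 'h \<Rightarrow> 'k" where
  "dual_comult \<phi> = (\<lambda>h g. \<phi> (h * g))"

definition dual_tensor :: "('h \<Rightarrow> 'k::field) \<Rightarrow> ('h \<Rightarrow> 'k) \<Rightarrow> 'h \<Rightarrow> 'h \<Rightarrow> 'k" where
  "dual_tensor \<phi> \<psi> = (\<lambda>h g. \<phi> h * \<psi> g)"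

text \<open>
  The product of \<open>H\<^sup>* \<otimes> H\<^sup>*\<close>: as
  \<open>\<langle>(\<phi> \<otimes> \<psi>)(\<phi>' \<otimes> \<psi>'), h \<otimes> g\<rangle> = \<phi>(h\<^sub>1) \<phi>'(h\<^sub>2) \<psi>(g\<^sub>1) \<psi>'(g\<^sub>2)\<close>, it is convolution of bilinear forms.
\<close>

definition dual_tensor_mult ::
  "('k::field, 'h::ring) weak_hopf \<Rightarrow> ('h \<Rightarrow> 'h \<Rightarrow> 'k) \<Rightarrow> ('h \<Rightarrow> 'h \<Rightarrow> 'k) \<Rightarrow> 'h \<Rightarrow> 'h \<Rightarrow> 'k" where
  "dual_tensor_mult H A B =
     (\<lambda>h g. \<Sum>(a, b)\<leftarrow>comult H h. \<Sum>(c, d)\<leftarrow>comult H g. A a c * B b d)"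

text \<open>The unit of \<open>H\<^sup>*\<close> is \<open>counit H\<close>.\<close>

definition dual_inverse :: "('k::field, 'h::ring) weak_hopf \<Rightarrow> ('h \<Rightarrow> 'k) \<Rightarrow> ('h \<Rightarrow> 'k) \<Rightarrow> bool" where
  "dual_inverse H \<xi> \<xi>' \<longleftrightarrow> \<xi> \<in> dual_space H \<and> \<xi>' \<in> dual_space H \<and>
     dual_mult H \<xi> \<xi>' = counit H \<and> dual_mult H \<xi>' \<xi> = counit H"

definition dual_grouplike :: "('k::field, 'h::ring) weak_hopf \<Rightarrow> ('h \<Rightarrow> 'k) \<Rightarrow> bool" where
  "dual_grouplike H \<gamma> \<longleftrightarrow> (\<exists>\<gamma>'. dual_inverse H \<gamma> \<gamma>') \<and>
     dual_comult \<gamma> = dual_tensor_mult H (dual_tensor \<gamma> \<gamma>) (dual_comult (counit H)) \<and>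
     dual_comult \<gamma> = dual_tensor_mult H (dual_comult (counit H)) (dual_tensor \<gamma> \<gamma>)"

definition grouplike_group :: "('k::field, 'h::ring) weak_hopf \<Rightarrow> ('h \<Rightarrow> 'k) monoid" where
  "grouplike_group H =
     \<lparr>carrier = {\<gamma>. dual_grouplike H \<gamma>}, monoid.mult = dual_mult H, one = counit H\<rparr>"

text \<open>
  The source counital map of \<open>H\<^sup>*\<close> is \<open>\<phi> \<mapsto> 1\<^sub>1 \<langle>\<phi> 1\<^sub>2, 1\<rangle>\<close>, where \<open>1\<^sub>1 \<otimes> 1\<^sub>2 = \<Delta>(\<epsilon>)\<close>; evaluating the
  first factor at \<open>h\<close> turns \<open>1\<^sub>2\<close> into the functional \<open>g \<mapsto> \<epsilon>(h g)\<close>.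
\<close>

definition dual_eps_s :: "('k::field, 'h::ring) weak_hopf \<Rightarrow> ('h \<Rightarrow> 'k) \<Rightarrow> 'h \<Rightarrow> 'k" where
  "dual_eps_s H \<phi> = (\<lambda>h. dual_mult H \<phi> (dual_comult (counit H) h) (unit H))"

definition dual_base_s :: "('k::field, 'h::ring) weak_hopf \<Rightarrow> ('h \<Rightarrow> 'k) set" where
  "dual_base_s H = dual_eps_s H ` dual_space H"

definition trivial_grouplikes :: "('k::field, 'h::ring) weak_hopf \<Rightarrow> ('h \<Rightarrow> 'k) set" where
  "trivial_grouplikes H =
     {\<gamma>. dual_grouplike H \<gamma> \<and>
        (\<exists>\<xi> \<xi>'. \<xi> \<in> dual_base_s H \<and> dual_inverse H \<xi> \<xi>' \<and> \<gamma> = dual_mult H (dual_antipode H \<xi>) \<xi>')}"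


section \<open>Integrals and the modules on the source base\<close>

definition left_integrals :: "('k::field, 'h::ring) weak_hopf \<Rightarrow> 'h set" where
  "left_integrals H = {l. \<forall>h. h * l = eps_t H h * l}"

text \<open>Non-degeneracy of \<open>l\<close> as a functional \<open>\<phi> \<mapsto> \<phi>(l)\<close> on the algebra \<open>H\<^sup>*\<close>.\<close>

definition nondegenerate :: "('k::field, 'h::ring) weak_hopf \<Rightarrow> 'h \<Rightarrow> bool" where
  "nondegenerate H l \<longleftrightarrow>
     (\<forall>\<phi>\<in>dual_space H. (\<forall>\<psi>\<in>dual_space H. dual_mult H \<phi> \<psi> l = 0) \<longrightarrow> \<phi> = (\<lambda>_. 0)) \<and>
     (\<forall>\<psi>\<in>dual_space H. (\<forall>\<phi>\<in>dual_space H. dual_mult H \<phi> \<psi> l = 0) \<longrightarrow> \<psi> = (\<lambda>_. 0))"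

text \<open>Both actions below are right actions of \<open>H\<close> on \<open>base_s H\<close>, with arguments \<open>y \<in> base_s H\<close> and \<open>h\<close>.\<close>

definition grouplike_action ::
  "('k::field, 'h::ring) weak_hopf \<Rightarrow> ('h \<Rightarrow> 'k) \<Rightarrow> 'h \<Rightarrow> 'h \<Rightarrow> 'h" where
  "grouplike_action H \<gamma> y h =
     (\<Sum>(a, b)\<leftarrow>comult H (unit H). scal H (\<gamma> (y * h * a)) (antipode H b))"

definition integral_action ::
  "('k::field, 'h::ring) weak_hopf \<Rightarrow> 'h \<Rightarrow> 'h \<Rightarrow> 'h \<Rightarrow> 'h" where
  "integral_action H l y h = (THE z. z \<in> base_s H \<and> l * y * h = l * z)"

definition base_s_modules_isomorphic ::
  "('k::field, 'h::ring) weak_hopf \<Rightarrow> ('h \<Rightarrow> 'h \<Rightarrow> 'h) \<Rightarrow> ('h \<Rightarrow> 'h \<Rightarrow> 'h) \<Rightarrow> bool" where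
  "base_s_modules_isomorphic H act act' \<longleftrightarrow>
     (\<exists>f. bij_betw f (base_s H) (base_s H) \<and>
        (\<forall>x\<in>base_s H. \<forall>y\<in>base_s H. f (x + y) = f x + f y) \<and>
        (\<forall>c. \<forall>x\<in>base_s H. f (scal H c x) = scal H c (f x)) \<and>
        (\<forall>y\<in>base_s H. \<forall>h. f (act y h) = act' (f y) h))"

end

theory Submission
  imports Defs
begin

text \<open>
  Fix a non-degenerate left integral \<open>l\<close>.  Multiplication by \<open>l\<close> identifies the source base \<open>H\<^sub>s\<close>
  with the space of all left integrals, so every \<open>h\<close> has a unique \<open>\<pi>(h) \<in> H\<^sub>s\<close> with
  \<open>l h = l \<pi>(h)\<close>, and the action on \<open>W\<^sub>l\<close> is \<open>y \<cdot> h = \<pi>(y h)\<close>.  When \<open>S\<^sup>2 = id\<close> on the bases, the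
  counit is a trace on \<open>H\<^sub>s\<close> with dual bases \<open>1\<^sub>1\<close>, \<open>S(1\<^sub>2)\<close>, so
  \<open>\<pi>(h) = \<alpha>(h 1\<^sub>1) S(1\<^sub>2)\<close> for \<open>\<alpha> = \<epsilon> \<circ> \<pi>\<close>.  Hence \<open>W\<^sub>l\<close> is literally the module \<open>H\<^sub>s\<^sup>\<alpha>\<close>, and
  two things remain: \<open>\<alpha>\<close> is group-like, and its coset is determined by the isomorphism class.

  \<^bold>\<open>Group-likeness\<close> (\<open>alpha_grouplike\<close>).  One half of \<open>\<Delta>(\<alpha>) = (\<alpha> \<otimes> \<alpha>)\<Delta>(1)\<close>,
  \<open>\<alpha>(h k) = \<alpha>(h 1\<^sub>1) \<alpha>(S(1\<^sub>2) k)\<close>, only says that \<open>\<pi>\<close> comes from a module structure.  The other half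
  involves the elements \<open>\<pi>(x)\<close>, \<open>x \<in> H\<^sub>t\<close>.  The map \<open>\<sigma> = \<pi> \<circ> S\<close> is an algebra automorphism of
  \<open>H\<^sub>s\<close>.  It need not be inner, but it fixes the tensor \<open>1\<^sub>1 \<otimes> S(1\<^sub>2)\<close>, because an algebra has at most
  one symmetric separability idempotent (\<open>casimir_automorphism_invariant\<close>); therefore it also
  preserves \<open>\<epsilon>\<close>.  This gives the second half, and \<open>\<alpha> \<circ> S\<close> is the convolution inverse.

  \<^bold>\<open>The coset.\<close>  Trivial group-like elements are exactly the functionals
  \<open>h \<mapsto> \<epsilon>(x h x\<^sup>-\<^sup>1)\<close> with \<open>x \<in> H\<^sub>t\<close> invertible (\<open>trivial_grouplikes_iff\<close>), so the coset of \<open>\<alpha>\<close>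
  consists of the functionals \<open>h \<mapsto> \<alpha>(x h x\<^sup>-\<^sup>1)\<close>.  The map \<open>y \<mapsto> \<pi>(x\<^sup>-\<^sup>1 y)\<close> is an isomorphism from
  \<open>W\<^sub>l\<close> to the corresponding module.  Conversely, an isomorphism \<open>W\<^sub>l \<cong> H\<^sub>s\<^sup>\<gamma>\<close> is right
  \<open>H\<^sub>s\<close>-linear, so it is left multiplication by an invertible \<open>u \<in> H\<^sub>s\<close>, which gives
  \<open>\<gamma>(h) = \<epsilon>(u \<pi>(u\<^sup>-\<^sup>1 h))\<close>.  As \<open>\<pi>\<close> maps \<open>H\<^sub>t\<close> bijectively onto \<open>H\<^sub>s\<close>, this can be rewritten as
  \<open>\<alpha>(x h x\<^sup>-\<^sup>1)\<close> with \<open>\<pi>(x) = u\<^sup>-\<^sup>1\<close>.  Another non-degenerate left integral has the form \<open>l u\<close>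
  with \<open>u \<in> H\<^sub>s\<close> invertible, and left multiplication by \<open>u\<close> is an isomorphism \<open>W\<^sub>l\<^sub>u \<cong> W\<^sub>l\<close>; so
  the coset does not depend on \<open>l\<close>.

  Identities between tensors are tested on multilinear forms with values in the field, and identities
  between vectors on functionals (\<open>vector_eqI\<close>).
\<close>

section \<open>Sweedler calculus\<close>

context weak_hopf_algebra begin

abbreviation scale (infixr "\<cdot>" 75) where "c \<cdot> x \<equiv> scal H c x"
abbreviation eps ("\<epsilon>") where "\<epsilon> \<equiv> counit H"
abbreviation anti ("S") where "S \<equiv> antipode H"
abbreviation one_H ("\<e>") where "\<e> \<equiv> unit H"
abbreviation et where "et \<equiv> eps_t H"
abbreviation es where "es \<equiv> eps_s H"
abbreviation Ht where "Ht \<equiv> base_t H"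
abbreviation Hs where "Hs \<equiv> base_s H"
abbreviation lform where "lform f \<equiv> Vector_Spaces.linear (scal H) (*) f"
abbreviation lmap where "lmap E \<equiv> Vector_Spaces.linear (scal H) (scal H) E"
abbreviation bilin where "bilin B \<equiv> bilinear_form (scal H) B"
abbreviation trilin where "trilin T \<equiv> trilinear_form (scal H) T"

text \<open>Sweedler notation: \<open>f(h\<^sub>1, h\<^sub>2)\<close>.\<close>

definition sw :: "'h \<Rightarrow> ('h \<Rightarrow> 'h \<Rightarrow> 'v::comm_monoid_add) \<Rightarrow> 'v" where
  "sw h f = (\<Sum>(a, b)\<leftarrow>comult H h. f a b)"

sublocale vs: vector_space "scal H"
  by (rule vector_space)

sublocale vk: vector_space "(*) :: 'k \<Rightarrow> 'k \<Rightarrow> 'k"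
  by unfold_locales (simp_all add: algebra_simps)

sublocale vp: vector_space_pair "scal H" "(*) :: 'k \<Rightarrow> 'k \<Rightarrow> 'k"
  by unfold_locales

lemma lform_iff: "lform f \<longleftrightarrow> (\<forall>x y. f (x + y) = f x + f y) \<and> (\<forall>c x. f (c \<cdot> x) = c * f x)"
  unfolding Vector_Spaces.linear_iff using vs.vector_space_axioms vk.vector_space_axioms by blast

lemma lmap_iff:
  "lmap f \<longleftrightarrow>
     (\<forall>x y. f (x + y) = f x + f y) \<and> (\<forall>c x. f (c \<cdot> x) = c \<cdot> f x)"
  unfolding Vector_Spaces.linear_iff using vs.vector_space_axioms by blast

lemma lformD:
  assumes "lform f"
  shows "f (x + y) = f x + f y" "f (c \<cdot> x) = c * f x" "f 0 = 0" "f (sw h g) = sw h (\<lambda>a b. f (g a b))"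
    "f (x - y) = f x - f y"
proof -
  show 1: "f (x + y) = f x + f y" "f (c \<cdot> x) = c * f x" for x y c using assms unfolding lform_iff by auto
  show 0: "f 0 = 0" using 1(1)[of 0 0] by (metis add_cancel_left_left)
  show "f (x - y) = f x - f y" using 1(1)[of "x - y" y] by simp
  have "f (sum_list (map (\<lambda>(a, b). g a b) xs)) = sum_list (map (\<lambda>(a, b). f (g a b)) xs)" for xs
    by (induct xs) (auto simp: 0 1)
  then show "f (sw h g) = sw h (\<lambda>a b. f (g a b))"
    unfolding sw_def .
qed

lemma bilD:
  assumes "bilin B"
  shows "B (x + y) z = B x z + B y z" "B z (x + y) = B z x + B z y"
    "B (c \<cdot> x) z = c * B x z" "B z (c \<cdot> x) = c * B z x"
    "B (sw h f) z = sw h (\<lambda>a b. B (f a b) z)" "B z (sw h f) = sw h (\<lambda>a b. B z (f a b))"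
proof -
  have l1: "lform (\<lambda>x. B x z)" and l2: "lform (\<lambda>x. B z x)" for z
    using assms unfolding bilinear_form_def by auto
  show "B (x + y) z = B x z + B y z" "B (c \<cdot> x) z = c * B x z"
    "B (sw h f) z = sw h (\<lambda>a b. B (f a b) z)"
    by (rule lformD[OF l1])+
  show "B z (x + y) = B z x + B z y" "B z (c \<cdot> x) = c * B z x"
    "B z (sw h f) = sw h (\<lambda>a b. B z (f a b))"
    by (rule lformD[OF l2])+
qed

lemma functional_separating_subspace:
  assumes U: "vs.subspace U" and x: "x \<notin> U"
  obtains f where "lform f" "\<And>u. u \<in> U \<Longrightarrow> f u = 0" "f x = 1"
proof -
  obtain B where B: "B \<subseteq> U" "vs.independent B" "U \<subseteq> vs.span B"
    by (rule vs.basis_exists[of U])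
  have sp: "vs.span B = U" by (rule subset_antisym[OF vs.span_minimal[OF B(1) U] B(3)])
  then have "x \<notin> vs.span B" using x by simp
  then have ind: "vs.independent (insert x B)"
    using B(2) by (simp add: vs.independent_insert)
  have xB: "x \<notin> B"
    using \<open>x \<notin> vs.span B\<close> vs.span_base by blast
  obtain f where f: "lform f" "\<forall>b\<in>insert x B. f b = (if b = x then 1 else 0)"
    using vp.linear_independent_extend[OF ind, of "\<lambda>b. if b = x then 1 else 0"] by (elim exE conjE)
  have "f u = 0" if "u \<in> U" for u
  proof -
    have "u \<in> vs.span B" using that sp by simp
    moreover have "f b = 0" if "b \<in> B" for b
      using bspec[OF f(2) insertI2[OF that]] xB that by (cases "b = x") simp_all
    ultimately show ?thesis
      by (rule vp.linear_eq_0_on_span[OF f(1), rotated])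
  qed
  moreover have "f x = 1" using f(2) by simp
  ultimately show thesis by (rule that[OF f(1)])
qed

text \<open>
  Vector identities are proved by testing them on an arbitrary functional, because the axioms compare
  formal sums of tensors only through forms with values in the field.
\<close>

lemma vector_eqI:
  assumes "\<And>f. lform f \<Longrightarrow> f x = f y"
  shows "x = y"
proof (rule ccontr)
  assume "x \<noteq> y"
  then have "x - y \<notin> {0}" by simp
  then obtain f where f: "lform f" "f (x - y) = 1"
    by (rule functional_separating_subspace[OF vs.subspace_single_0])
  then show False using assms[OF f(1)] lformD(5)[OF f(1), of x y] by simp
qed

text \<open>
  Without this rule the simplifier meets eta-contracted summands such as \<open>\<lambda>a. B (f a)\<close> and
  cannot apply linearity of \<open>B\<close> to them.
\<close>

lemma sw_cong [cong]: "h = h' \<Longrightarrow> (\<And>a b. f a b = g a b) \<Longrightarrow> sw h f = sw h' g"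
  by presburger

lemma sw_add_fun: "sw h (\<lambda>a b. f a b + g a b) = sw h f + sw h g"
proof -
  have "sum_list (map (\<lambda>(a, b). f a b + g a b) xs)
     = sum_list (map (\<lambda>(a, b). f a b) xs) + sum_list (map (\<lambda>(a, b). g a b) xs)" for xs
    by (induct xs) (auto simp: algebra_simps)
  then show ?thesis unfolding sw_def .
qed

lemma sw_zero: "sw h (\<lambda>a b. 0) = 0"
proof -
  have "sum_list (map (\<lambda>(a, b). 0) xs) = 0" for xs :: "('h \<times> 'h) list"
    by (induct xs) auto
  then show ?thesis unfolding sw_def .
qed

lemma sw_swap: "sw h (\<lambda>a b. sw g (\<lambda>c d. f a b c d)) = sw g (\<lambda>c d. sw h (\<lambda>a b. f a b c d))"
proof -
  have "sum_list (map (\<lambda>(a, b). sw g (\<lambda>c d. f a b c d)) xs)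
    = sw g (\<lambda>c d. sum_list (map (\<lambda>(a, b). f a b c d) xs))" for xs
    by (induct xs) (auto simp: sw_add_fun sw_zero)
  then show ?thesis unfolding sw_def .
qed

lemma sw_mult_left: "x * sw h f = sw h (\<lambda>a b. x * f a b)" for x :: "'v::semiring_0"
proof -
  have "x * sum_list (map (\<lambda>(a, b). f a b) xs) = sum_list (map (\<lambda>(a, b). x * f a b) xs)" for xs
    by (induct xs) (auto simp: algebra_simps)
  then show ?thesis unfolding sw_def .
qed

lemma sw_mult_right: "sw h f * x = sw h (\<lambda>a b. f a b * x)" for x :: "'v::semiring_0"
proof -
  have "sum_list (map (\<lambda>(a, b). f a b) xs) * x = sum_list (map (\<lambda>(a, b). f a b * x) xs)" for xs
    by (induct xs) (auto simp: algebra_simps)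
  then show ?thesis unfolding sw_def .
qed

lemma lmapD:
  assumes "lmap f"
  shows "f (x + y) = f x + f y" "f (c \<cdot> x) = c \<cdot> f x" "f (sw h g) = sw h (\<lambda>a b. f (g a b))"
    "f 0 = 0" "f (x - y) = f x - f y"
proof -
  show 1: "f (x + y) = f x + f y" "f (c \<cdot> x) = c \<cdot> f x" for x y c
    using assms unfolding lmap_iff by auto
  show 0: "f 0 = 0" using 1(1)[of 0 0] by (metis add_cancel_left_left)
  show "f (x - y) = f x - f y" using 1(1)[of "x - y" y] by simp
  have "f (sum_list (map (\<lambda>(a, b). g a b) xs)) = sum_list (map (\<lambda>(a, b). f (g a b)) xs)" for xs
    by (induct xs) (auto simp: 0 1)
  then show "f (sw h g) = sw h (\<lambda>a b. f (g a b))" unfolding sw_def .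
qed

lemmas eps_lin = lformD[OF counit_linear]

lemma sw_scale_left: "x \<cdot> sw h f = sw h (\<lambda>a b. x \<cdot> f a b)"
proof -
  have "x \<cdot> sum_list (map (\<lambda>(a, b). f a b) xs) = sum_list (map (\<lambda>(a, b). x \<cdot> f a b) xs)" for xs
    by (induct xs) (auto simp: vs.scale_right_distrib)
  then show ?thesis unfolding sw_def .
qed

lemma et_alt: "et h = sw \<e> (\<lambda>a b. \<epsilon> (a * h) \<cdot> b)"
  unfolding eps_t_def sw_def ..

lemma es_alt: "es h = sw \<e> (\<lambda>a b. \<epsilon> (h * b) \<cdot> a)"
  unfolding eps_s_def sw_def ..

lemmas ring_lin = distrib_left distrib_right mult_scal_left mult_scal_right
lemmas push = sw_mult_left sw_mult_right sw_scale_left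
lemmas vscale = vs.scale_right_distrib vs.scale_left_distrib vs.scale_scale

lemma et_lmap: "lmap et"
  unfolding lmap_iff et_alt
  by (auto simp: ring_lin eps_lin vscale sw_add_fun push mult.commute)

lemma es_lmap: "lmap es"
  unfolding lmap_iff es_alt
  by (auto simp: ring_lin eps_lin vscale sw_add_fun push mult.commute)

lemma et_f: "lform f \<Longrightarrow> f (et h) = sw \<e> (\<lambda>a b. \<epsilon> (a * h) * f b)"
  unfolding et_alt by (simp add: lformD)

lemma es_f: "lform f \<Longrightarrow> f (es h) = sw \<e> (\<lambda>a b. \<epsilon> (h * b) * f a)"
  unfolding es_alt by (simp add: lformD)

text \<open>
  These two lemmas turn sums over the nested list comprehensions of the axioms into iterated
  Sweedler sums.
\<close>

lemma sw_concat: "sum_list (map (\<lambda>(a, b). f a b) (concat (map (\<lambda>(a, b). map (\<lambda>(c, d). (p a b c d, q a b c d)) (comult H (r a b))) (comult H h))))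
   = sw h (\<lambda>a b. sw (r a b) (\<lambda>c d. f (p a b c d) (q a b c d)))"
proof -
  have "sum_list (map (\<lambda>(a, b). f a b) (concat (map (\<lambda>(a, b). map (\<lambda>(c, d). (p a b c d, q a b c d)) (comult H (r a b))) xs)))
   = sum_list (map (\<lambda>(a, b). sw (r a b) (\<lambda>c d. f (p a b c d) (q a b c d))) xs)" for xs
    unfolding sw_def by (induct xs) (auto simp: comp_def case_prod_unfold)
  then show ?thesis unfolding sw_def .
qed

lemma sw_concat3: "sum_list (map (\<lambda>(a, b, c). f a b c) (concat (map (\<lambda>(a, b). map (\<lambda>(c, d). (p a b c d, q a b c d, t a b c d)) (comult H (r a b))) (comult H h))))
   = sw h (\<lambda>a b. sw (r a b) (\<lambda>c d. f (p a b c d) (q a b c d) (t a b c d)))"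
proof -
  have "sum_list (map (\<lambda>(a, b, c). f a b c) (concat (map (\<lambda>(a, b). map (\<lambda>(c, d). (p a b c d, q a b c d, t a b c d)) (comult H (r a b))) xs)))
   = sum_list (map (\<lambda>(a, b). sw (r a b) (\<lambda>c d. f (p a b c d) (q a b c d) (t a b c d))) xs)" for xs
    unfolding sw_def by (induct xs) (auto simp: comp_def case_prod_unfold)
  then show ?thesis unfolding sw_def .
qed

lemma sw_add: "bilin B \<Longrightarrow> sw (x + y) B = sw x B + sw y B"
  using comult_add[of x y] unfolding tensor2_eq_def sw_def by simp

lemma sw_scal: "bilin B \<Longrightarrow> sw (c \<cdot> x) B = c * sw x B"
proof -
  assume B: "bilin B"
  have "sw (c \<cdot> x) B = sw x (\<lambda>a b. B (c \<cdot> a) b)"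
    using comult_scal[of c x] B unfolding tensor2_eq_def sw_def
    by (simp add: comp_def case_prod_unfold)
  then show ?thesis by (simp add: bilD[OF B] sw_mult_left)
qed

lemma sw_coassoc:
  "trilin T \<Longrightarrow> sw h (\<lambda>a b. sw a (\<lambda>c d. T c d b)) = sw h (\<lambda>a b. sw b (\<lambda>c d. T a c d))"
  using comult_coassoc[of h] unfolding tensor3_eq_def sw_concat3 by blast

lemma sw_mult: "bilin B \<Longrightarrow> sw (h * g) B = sw h (\<lambda>a b. sw g (\<lambda>c d. B (a * c) (b * d)))"
  using comult_mult[of h g] unfolding tensor2_eq_def sw_concat by (simp add: sw_def)

lemma sw_unit1:
  "trilin T \<Longrightarrow> sw \<e> (\<lambda>a b. sw a (\<lambda>c d. T c d b)) = sw \<e> (\<lambda>a b. sw \<e> (\<lambda>c d. T a (b * c) d))"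
  using comult_unit1 unfolding tensor3_eq_def sw_concat3 by blast

lemma sw_unit2:
  "trilin T \<Longrightarrow> sw \<e> (\<lambda>a b. sw a (\<lambda>c d. T c d b)) = sw \<e> (\<lambda>a b. sw \<e> (\<lambda>c d. T a (c * b) d))"
  using comult_unit2 unfolding tensor3_eq_def sw_concat3 by blast

lemma sw_counit_left:
  assumes f: "lform f"
  shows "sw h (\<lambda>a b. \<epsilon> a * f b) = f h"
proof -
  have "f (sw h (\<lambda>a b. \<epsilon> a \<cdot> b)) = f h" using counit_left[of h] unfolding sw_def by simp
  then show ?thesis by (simp add: lformD[OF f])
qed

lemma sw_counit_right:
  assumes f: "lform f"
  shows "sw h (\<lambda>a b. f a * \<epsilon> b) = f h"
proof -
  have "f (sw h (\<lambda>a b. \<epsilon> b \<cdot> a)) = f h" using counit_right[of h] unfolding sw_def by simp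
  then show ?thesis by (simp add: lformD[OF f] mult.commute)
qed

lemma sw_antipode_right:
  assumes f: "lform f"
  shows "sw h (\<lambda>a b. f (a * S b)) = f (et h)"
proof -
  have "f (sw h (\<lambda>a b. a * S b)) = f (et h)" using antipode_right[of h] unfolding sw_def by simp
  then show ?thesis by (simp add: lformD[OF f])
qed

lemma sw_antipode_left:
  assumes f: "lform f"
  shows "sw h (\<lambda>a b. f (S a * b)) = f (es h)"
proof -
  have "f (sw h (\<lambda>a b. S a * b)) = f (es h)" using antipode_left[of h] unfolding sw_def by simp
  then show ?thesis by (simp add: lformD[OF f])
qed

lemma counit_mult1': "\<epsilon> (f * g * h) = sw g (\<lambda>a b. \<epsilon> (f * a) * \<epsilon> (b * h))"
  and counit_mult2': "\<epsilon> (f * g * h) = sw g (\<lambda>a b. \<epsilon> (f * b) * \<epsilon> (a * h))"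
  using counit_mult1 counit_mult2 unfolding sw_def by auto

lemma bilI: "(\<And>a. lform (\<lambda>x. B a x)) \<Longrightarrow> (\<And>b. lform (\<lambda>x. B x b)) \<Longrightarrow> bilin B"
  unfolding bilinear_form_def by auto

lemma triI: "(\<And>b c. lform (\<lambda>x. T x b c)) \<Longrightarrow> (\<And>a c. lform (\<lambda>x. T a x c)) \<Longrightarrow> (\<And>a b. lform (\<lambda>x. T a b x)) \<Longrightarrow> trilin T"
  unfolding trilinear_form_def by auto

text \<open>
  The following rules decide the linearity side conditions syntactically.  Each conclusion is a
  higher-order pattern, so \<open>intro\<close> builds the derivation without search.
\<close>

lemma lform_mult_left:
  assumes "lform F" shows "lform (\<lambda>x. c * F x)"
  unfolding lform_iff lformD[OF assms] by (intro conjI allI distrib_left mult.left_commute)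

lemma lform_mult_right:
  assumes "lform F" shows "lform (\<lambda>x. F x * c)"
  unfolding lform_iff lformD[OF assms] by (intro conjI allI distrib_right mult.assoc)

lemma lform_sw_arg:
  assumes "bilin B" "lmap E"
  shows "lform (\<lambda>x. sw (E x) B)"
  unfolding lform_iff lmapD[OF assms(2)] using sw_add[OF assms(1)] sw_scal[OF assms(1)] by blast

lemma lform_sw_body: "(\<And>a b. lform (F a b)) \<Longrightarrow> lform (\<lambda>x. sw h (\<lambda>a b. F a b x))"
  unfolding lform_iff by (simp add: sw_add_fun sw_mult_left)

lemma lform_comp:
  assumes "lform f" "lmap E"
  shows "lform (\<lambda>x. f (E x))"
  unfolding lform_iff lmapD[OF assms(2)] lformD[OF assms(1)] by blast

lemma lform_bil1: "bilin B \<Longrightarrow> lmap E \<Longrightarrow> lform (\<lambda>x. B (E x) z)"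
  and lform_bil2: "bilin B \<Longrightarrow> lmap E \<Longrightarrow> lform (\<lambda>x. B z (E x))"
  unfolding bilinear_form_def by (rule lform_comp; blast)+

lemma lmap_comp: "lmap f \<Longrightarrow> lmap E \<Longrightarrow> lmap (\<lambda>x. f (E x))"
  unfolding lmap_iff by simp

lemma lmap_id: "lmap (\<lambda>x. x)"
  unfolding lmap_iff by simp

lemma lmap_mult_left: "lmap E \<Longrightarrow> lmap (\<lambda>x. c * E x)"
  and lmap_mult_right: "lmap E \<Longrightarrow> lmap (\<lambda>x. E x * c)"
  unfolding lmap_iff by (simp_all add: distrib_left distrib_right mult_scal_left mult_scal_right)

lemma lmap_scale: "lform f \<Longrightarrow> lmap (\<lambda>x. f x \<cdot> v)"
  unfolding lmap_iff lform_iff by (simp add: vs.scale_left_distrib)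

lemma lmap_sw_body: "(\<And>a b. lmap (F a b)) \<Longrightarrow> lmap (\<lambda>x. sw h (\<lambda>a b. F a b x))"
  unfolding lmap_iff by (simp add: sw_add_fun sw_scale_left)

text \<open>
  The counital maps with the other order of multiplication in the argument of \<open>\<epsilon>\<close>, usually written
  with a bar over \<open>\<epsilon>\<^sub>s\<close> and \<open>\<epsilon>\<^sub>t\<close>.
\<close>

definition ebs :: "'h \<Rightarrow> 'h" where "ebs h = sw \<e> (\<lambda>a b. \<epsilon> (b * h) \<cdot> a)"
definition ebt :: "'h \<Rightarrow> 'h" where "ebt h = sw \<e> (\<lambda>a b. \<epsilon> (h * a) \<cdot> b)"

lemma ebt_lmap: "lmap ebt"
  unfolding ebt_def[abs_def]
  by (intro lmap_sw_body lmap_scale lform_comp[OF counit_linear] lmap_mult_left lmap_mult_right lmap_id)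

lemma ebs_lmap: "lmap ebs"
  unfolding ebs_def[abs_def]
  by (intro lmap_sw_body lmap_scale lform_comp[OF counit_linear] lmap_mult_left lmap_mult_right lmap_id)

lemma ebt_f: "lform f \<Longrightarrow> f (ebt h) = sw \<e> (\<lambda>a b. \<epsilon> (h * a) * f b)"
  unfolding ebt_def by (simp add: lformD)

lemma ebs_f: "lform f \<Longrightarrow> f (ebs h) = sw \<e> (\<lambda>a b. \<epsilon> (b * h) * f a)"
  unfolding ebs_def by (simp add: lformD)

lemmas lin_intros = bilI triI lform_mult_left lform_mult_right lform_sw_arg lform_sw_body
  lmap_id lmap_mult_left lmap_mult_right lform_comp[OF counit_linear]
  lmap_comp[OF antipode_linear] lmap_comp[OF et_lmap] lmap_comp[OF es_lmap]
  lmap_comp[OF ebt_lmap] lmap_comp[OF ebs_lmap] lmap_scale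

lemma lform_sw: "bilin B \<Longrightarrow> lform (\<lambda>h. sw h B)"
  by (rule lform_sw_arg[OF _ lmap_id])

section \<open>Counital maps and bases\<close>

lemma et_one: "et \<e> = \<e>"
  by (rule vector_eqI) (simp add: et_f sw_counit_left unit_right)

lemma es_one: "es \<e> = \<e>"
  by (rule vector_eqI) (simp add: es_f sw_counit_right unit_left mult.commute[of "\<epsilon> _"])

text \<open>The two axioms on \<open>(\<Delta> \<otimes> id)\<Delta>(1)\<close>, moved to \<open>(id \<otimes> \<Delta>)\<Delta>(1)\<close> by coassociativity.\<close>

lemma sw_unit1':
  assumes "trilin T"
  shows "sw \<e> (\<lambda>a b. sw b (\<lambda>c d. T a c d)) = sw \<e> (\<lambda>a b. sw \<e> (\<lambda>c d. T a (b * c) d))"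
  by (rule trans[OF sw_coassoc[OF assms, symmetric] sw_unit1[OF assms]])

lemma sw_unit2':
  assumes "trilin T"
  shows "sw \<e> (\<lambda>a b. sw b (\<lambda>c d. T a c d)) = sw \<e> (\<lambda>a b. sw \<e> (\<lambda>c d. T a (c * b) d))"
  by (rule trans[OF sw_coassoc[OF assms, symmetric] sw_unit2[OF assms]])

text \<open>
  \<open>h\<^sub>1 \<otimes> \<epsilon>\<^sub>t(h\<^sub>2) = 1\<^sub>1 h \<otimes> 1\<^sub>2\<close>: a counit is inserted into \<open>1\<^sub>1 h\<close>, comultiplicativity splits the
  product, and one of the axioms on \<open>(\<Delta> \<otimes> id)\<Delta>(1)\<close> lets the first two legs of
  \<open>1\<^sub>1 \<otimes> 1\<^sub>2 \<otimes> 1\<^sub>3\<close> be absorbed by \<open>\<Delta>(h)\<close>.  The next two lemmas are obtained in the same way, from the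
  other side or with the other axiom.
\<close>

lemma sw_et:
  assumes B: "bilin B"
  shows "sw h (\<lambda>a b. B a (et b)) = sw \<e> (\<lambda>a b. B (a * h) b)"
proof -
  have "sw \<e> (\<lambda>a b. B (a * h) b) = sw \<e> (\<lambda>a b. sw (a * h) (\<lambda>c d. B c b * \<epsilon> d))"
    by (rule sw_cong[OF refl], rule sw_counit_right[symmetric]) (intro lin_intros lform_bil1[OF B] lform_bil2[OF B])
  also have "\<dots> = sw \<e> (\<lambda>a b. sw a (\<lambda>c d. sw h (\<lambda>p q. B (c * p) b * \<epsilon> (d * q))))"
    by (rule sw_cong[OF refl], rule trans[OF sw_mult]) (intro lin_intros lform_bil1[OF B] lform_bil2[OF B], rule refl)
  also have "\<dots> = sw \<e> (\<lambda>a b. sw \<e> (\<lambda>c d. sw h (\<lambda>p q. B (a * p) d * \<epsilon> ((c * b) * q))))"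
    by (rule trans[OF sw_unit2]) (intro lin_intros lform_bil1[OF B] lform_bil2[OF B], rule refl)
  also have "\<dots> = sw \<e> (\<lambda>c d. sw \<e> (\<lambda>a b. sw h (\<lambda>p q. B (a * p) d * \<epsilon> (c * (b * q)))))"
    by (rule trans[OF sw_swap]) (simp only: mult.assoc)
  also have "\<dots> = sw \<e> (\<lambda>c d. sw (\<e> * h) (\<lambda>p q. B p d * \<epsilon> (c * q)))"
    by (rule sw_cong[OF refl], rule sym, rule trans[OF sw_mult]) (intro lin_intros lform_bil1[OF B] lform_bil2[OF B], rule refl)
  also have "\<dots> = sw h (\<lambda>a b. sw \<e> (\<lambda>c d. B a d * \<epsilon> (c * b)))"
    unfolding unit_left by (rule sw_swap)
  also have "\<dots> = sw h (\<lambda>a b. B a (et b))"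
    by (simp add: et_alt bilD[OF B] mult.commute)
  finally show ?thesis by simp
qed

lemma sw_es:
  assumes B: "bilin B"
  shows "sw h (\<lambda>a b. B (es a) b) = sw \<e> (\<lambda>a b. B a (h * b))"
proof -
  have "sw \<e> (\<lambda>a b. B a (h * b)) = sw \<e> (\<lambda>a b. sw (h * b) (\<lambda>c d. \<epsilon> c * B a d))"
    by (rule sw_cong[OF refl], rule sw_counit_left[symmetric]) (intro lin_intros lform_bil1[OF B] lform_bil2[OF B])
  also have "\<dots> = sw \<e> (\<lambda>a b. sw h (\<lambda>p q. sw b (\<lambda>c d. \<epsilon> (p * c) * B a (q * d))))"
    by (rule sw_cong[OF refl], rule trans[OF sw_mult]) (intro lin_intros lform_bil1[OF B] lform_bil2[OF B], rule refl)
  also have "\<dots> = sw \<e> (\<lambda>a b. sw b (\<lambda>c d. sw h (\<lambda>p q. \<epsilon> (p * c) * B a (q * d))))"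
    by (rule sw_cong[OF refl], rule sw_swap)
  also have "\<dots> = sw \<e> (\<lambda>a b. sw \<e> (\<lambda>c d. sw h (\<lambda>p q. \<epsilon> (p * (c * b)) * B a (q * d))))"
    by (rule trans[OF sw_unit2']) (intro lin_intros lform_bil1[OF B] lform_bil2[OF B], rule refl)
  also have "\<dots> = sw \<e> (\<lambda>a b. sw h (\<lambda>p q. sw \<e> (\<lambda>c d. \<epsilon> ((p * c) * b) * B a (q * d))))"
    unfolding mult.assoc by (rule sw_cong[OF refl], rule sw_swap)
  also have "\<dots> = sw \<e> (\<lambda>a b. sw (h * \<e>) (\<lambda>p q. \<epsilon> (p * b) * B a q))"
    by (rule sw_cong[OF refl], rule sym, rule trans[OF sw_mult]) (intro lin_intros lform_bil1[OF B] lform_bil2[OF B], rule refl)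
  also have "\<dots> = sw h (\<lambda>p q. sw \<e> (\<lambda>a b. \<epsilon> (p * b) * B a q))"
    unfolding unit_right by (rule sw_swap)
  also have "\<dots> = sw h (\<lambda>a b. B (es a) b)"
    by (simp add: es_alt bilD[OF B])
  finally show ?thesis by simp
qed

lemma sw_ebt:
  assumes B: "bilin B"
  shows "sw h (\<lambda>a b. B a (ebt b)) = sw \<e> (\<lambda>a b. B (h * a) b)"
proof -
  have "sw \<e> (\<lambda>a b. B (h * a) b) = sw \<e> (\<lambda>a b. sw (h * a) (\<lambda>c d. B c b * \<epsilon> d))"
    by (rule sw_cong[OF refl], rule sw_counit_right[symmetric]) (intro lin_intros lform_bil1[OF B] lform_bil2[OF B])
  also have "\<dots> = sw \<e> (\<lambda>a b. sw h (\<lambda>p q. sw a (\<lambda>c d. B (p * c) b * \<epsilon> (q * d))))"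
    by (rule sw_cong[OF refl], rule trans[OF sw_mult]) (intro lin_intros lform_bil1[OF B] lform_bil2[OF B], rule refl)
  also have "\<dots> = sw \<e> (\<lambda>a b. sw a (\<lambda>c d. sw h (\<lambda>p q. B (p * c) b * \<epsilon> (q * d))))"
    by (rule sw_cong[OF refl], rule sw_swap)
  also have "\<dots> = sw \<e> (\<lambda>a b. sw \<e> (\<lambda>c d. sw h (\<lambda>p q. B (p * a) d * \<epsilon> (q * (b * c)))))"
    by (rule trans[OF sw_unit1]) (intro lin_intros lform_bil1[OF B] lform_bil2[OF B], rule refl)
  also have "\<dots> = sw \<e> (\<lambda>c d. sw \<e> (\<lambda>a b. sw h (\<lambda>p q. B (p * a) d * \<epsilon> ((q * b) * c))))"
    by (rule trans[OF sw_swap]) (simp only: mult.assoc)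
  also have "\<dots> = sw \<e> (\<lambda>c d. sw h (\<lambda>p q. sw \<e> (\<lambda>a b. B (p * a) d * \<epsilon> ((q * b) * c))))"
    by (rule sw_cong[OF refl], rule sw_swap)
  also have "\<dots> = sw \<e> (\<lambda>c d. sw (h * \<e>) (\<lambda>p q. B p d * \<epsilon> (q * c)))"
    by (rule sw_cong[OF refl], rule sym, rule trans[OF sw_mult]) (intro lin_intros lform_bil1[OF B] lform_bil2[OF B], rule refl)
  also have "\<dots> = sw h (\<lambda>a b. sw \<e> (\<lambda>c d. B a d * \<epsilon> (b * c)))"
    unfolding unit_right by (rule sw_swap)
  also have "\<dots> = sw h (\<lambda>a b. B a (ebt b))"
    by (simp add: ebt_def bilD[OF B] mult.commute)
  finally show ?thesis by simp
qed

text \<open>The axioms on \<open>\<epsilon>(f g h)\<close> for \<open>g = 1\<close>: the counit sees its arguments only through the bases.\<close>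

lemma eps_et: "\<epsilon> (g * et h) = \<epsilon> (g * h)"
proof -
  have "\<epsilon> (g * et h) = sw \<e> (\<lambda>a b. \<epsilon> (a * h) * \<epsilon> (g * b))"
    by (rule et_f) (intro lin_intros)
  also have "\<dots> = \<epsilon> (g * \<e> * h)"
    unfolding counit_mult2' by (simp add: mult.commute)
  finally show ?thesis by (simp add: unit_right)
qed

lemma eps_es: "\<epsilon> (es g * h) = \<epsilon> (g * h)"
proof -
  have "\<epsilon> (es g * h) = sw \<e> (\<lambda>a b. \<epsilon> (g * b) * \<epsilon> (a * h))"
    by (rule es_f) (intro lin_intros)
  also have "\<dots> = \<epsilon> (g * \<e> * h)"
    unfolding counit_mult2' by (simp add: mult.commute)
  finally show ?thesis by (simp add: unit_right)
qed

lemma eps_ebs: "\<epsilon> (g * ebs h) = \<epsilon> (g * h)"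
proof -
  have "\<epsilon> (g * ebs h) = sw \<e> (\<lambda>a b. \<epsilon> (b * h) * \<epsilon> (g * a))"
    by (rule ebs_f) (intro lin_intros)
  also have "\<dots> = \<epsilon> (g * \<e> * h)"
    unfolding counit_mult1' by (simp add: mult.commute)
  finally show ?thesis by (simp add: unit_right)
qed

lemma eps_ebt: "\<epsilon> (ebt g * h) = \<epsilon> (g * h)"
proof -
  have "\<epsilon> (ebt g * h) = sw \<e> (\<lambda>a b. \<epsilon> (g * a) * \<epsilon> (b * h))"
    by (rule ebt_f) (intro lin_intros)
  also have "\<dots> = \<epsilon> (g * \<e> * h)"
    unfolding counit_mult1' by (simp add: mult.commute)
  finally show ?thesis by (simp add: unit_right)
qed

text \<open>
  Comultiplication on the bases is a multiple of \<open>\<Delta>(1)\<close>: writing \<open>x = \<epsilon>(1\<^sub>1 h) 1\<^sub>2\<close>, the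
  coproduct of \<open>x\<close> is \<open>\<epsilon>(1\<^sub>1 h) 1\<^sub>2 \<otimes> 1\<^sub>3\<close>, and each of the two axioms on \<open>\<Delta>(1)\<close> gives one form.
\<close>

lemma sw_Ht:
  assumes x: "x \<in> Ht" and B: "bilin B"
  shows "sw x B = sw \<e> (\<lambda>a b. B (x * a) b)" "sw x B = sw \<e> (\<lambda>a b. B (a * x) b)"
proof -
  obtain h where h: "x = et h" using x unfolding base_t_def by blast
  have 0: "sw x B = sw \<e> (\<lambda>a b. sw b (\<lambda>c d. \<epsilon> (a * h) * B c d))"
    unfolding h by (rule trans[OF et_f[OF lform_sw[OF B]]]) (simp add: sw_mult_left)
  also have "\<dots> = sw \<e> (\<lambda>a b. sw \<e> (\<lambda>c d. \<epsilon> (a * h) * B (b * c) d))"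
    by (rule trans[OF sw_unit1']) (intro lin_intros lform_bil1[OF B] lform_bil2[OF B], rule refl)
  also have "\<dots> = sw \<e> (\<lambda>c d. sw \<e> (\<lambda>a b. \<epsilon> (a * h) * B (b * c) d))"
    by (rule sw_swap)
  also have "\<dots> = sw \<e> (\<lambda>c d. B (et h * c) d)"
    by (rule sw_cong[OF refl], rule et_f[symmetric]) (intro lin_intros lform_bil1[OF B] lform_bil2[OF B])
  finally show "sw x B = sw \<e> (\<lambda>a b. B (x * a) b)" unfolding h .
  have "sw x B = sw \<e> (\<lambda>a b. sw \<e> (\<lambda>c d. \<epsilon> (a * h) * B (c * b) d))"
    unfolding 0 by (rule trans[OF sw_unit2']) (intro lin_intros lform_bil1[OF B] lform_bil2[OF B], rule refl)
  also have "\<dots> = sw \<e> (\<lambda>c d. sw \<e> (\<lambda>a b. \<epsilon> (a * h) * B (c * b) d))"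
    by (rule sw_swap)
  also have "\<dots> = sw \<e> (\<lambda>c d. B (c * et h) d)"
    by (rule sw_cong[OF refl], rule et_f[symmetric]) (intro lin_intros lform_bil1[OF B] lform_bil2[OF B])
  finally show "sw x B = sw \<e> (\<lambda>a b. B (a * x) b)" unfolding h .
qed

lemma sw_Hs:
  assumes x: "y \<in> Hs" and B: "bilin B"
  shows "sw y B = sw \<e> (\<lambda>a b. B a (b * y))" "sw y B = sw \<e> (\<lambda>a b. B a (y * b))"
proof -
  obtain h where h: "y = es h" using x unfolding base_s_def by blast
  have 0: "sw y B = sw \<e> (\<lambda>a b. sw a (\<lambda>c d. \<epsilon> (h * b) * B c d))"
    unfolding h by (rule trans[OF es_f[OF lform_sw[OF B]]]) (simp add: sw_mult_left)
  also have "\<dots> = sw \<e> (\<lambda>a b. sw \<e> (\<lambda>c d. \<epsilon> (h * d) * B a (b * c)))"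
    by (rule trans[OF sw_unit1]) (intro lin_intros lform_bil1[OF B] lform_bil2[OF B], rule refl)
  also have "\<dots> = sw \<e> (\<lambda>a b. B a (b * es h))"
    by (rule sw_cong[OF refl], rule es_f[symmetric]) (intro lin_intros lform_bil1[OF B] lform_bil2[OF B])
  finally show "sw y B = sw \<e> (\<lambda>a b. B a (b * y))" unfolding h .
  have "sw y B = sw \<e> (\<lambda>a b. sw \<e> (\<lambda>c d. \<epsilon> (h * d) * B a (c * b)))"
    unfolding 0 by (rule trans[OF sw_unit2]) (intro lin_intros lform_bil1[OF B] lform_bil2[OF B], rule refl)
  also have "\<dots> = sw \<e> (\<lambda>a b. B a (es h * b))"
    by (rule sw_cong[OF refl], rule es_f[symmetric]) (intro lin_intros lform_bil1[OF B] lform_bil2[OF B])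
  finally show "sw y B = sw \<e> (\<lambda>a b. B a (y * b))" unfolding h .
qed

lemma et_Ht: "x \<in> Ht \<Longrightarrow> et x = x"
proof (rule vector_eqI)
  fix f assume x: "x \<in> Ht" and f: "lform f"
  have "f x = sw x (\<lambda>a b. \<epsilon> a * f b)" by (rule sw_counit_left[OF f, symmetric])
  also have "\<dots> = f (et x)"
    by (rule trans[OF sw_Ht(2)[OF x]]) (intro lin_intros lform_comp[OF f], simp only: et_f[OF f])
  finally show "f (et x) = f x" by simp
qed

lemma ebt_Ht: "x \<in> Ht \<Longrightarrow> ebt x = x"
proof (rule vector_eqI)
  fix f assume x: "x \<in> Ht" and f: "lform f"
  have "f x = sw x (\<lambda>a b. \<epsilon> a * f b)" by (rule sw_counit_left[OF f, symmetric])
  also have "\<dots> = f (ebt x)"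
    by (rule trans[OF sw_Ht(1)[OF x]]) (intro lin_intros lform_comp[OF f], simp only: ebt_f[OF f])
  finally show "f (ebt x) = f x" by simp
qed

lemma es_Hs: "y \<in> Hs \<Longrightarrow> es y = y"
proof (rule vector_eqI)
  fix f assume x: "y \<in> Hs" and f: "lform f"
  have "f y = sw y (\<lambda>a b. \<epsilon> b * f a)"
    by (rule trans[OF sw_counit_right[OF f, symmetric]]) (simp add: mult.commute)
  also have "\<dots> = f (es y)"
    by (rule trans[OF sw_Hs(2)[OF x]]) (intro lin_intros lform_comp[OF f], simp only: es_f[OF f])
  finally show "f (es y) = f y" by simp
qed

lemma one_Ht: "\<e> \<in> Ht" unfolding base_t_def using et_one by (metis rangeI)
lemma one_Hs: "\<e> \<in> Hs" unfolding base_s_def using es_one by (metis rangeI)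
lemma et_in: "et h \<in> Ht" unfolding base_t_def by blast
lemma es_in: "es h \<in> Hs" unfolding base_s_def by blast

text \<open>
  The bases commute because the middle legs in the two axioms on \<open>(\<Delta> \<otimes> id)\<Delta>(1)\<close> are
  multiplied in opposite orders.
\<close>

lemma Ht_Hs_commute:
  assumes x: "x \<in> Ht" and y: "y \<in> Hs"
  shows "x * y = y * x"
proof (rule vector_eqI)
  fix f assume f: "lform f"
  obtain g h where gh: "x = et g" "y = es h" using x y unfolding base_t_def base_s_def by blast
  have "f (et g * es h) = sw \<e> (\<lambda>a b. \<epsilon> (a * g) * f (b * es h))"
    by (rule et_f) (intro lin_intros lform_comp[OF f])
  also have "\<dots> = sw \<e> (\<lambda>a b. sw \<e> (\<lambda>c d. \<epsilon> (a * g) * (\<epsilon> (h * d) * f (b * c))))"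
    by (rule sw_cong[OF refl], unfold sw_mult_left[symmetric], rule arg_cong[where f="(*) _"], rule es_f) (intro lin_intros lform_comp[OF f])
  also have "\<dots> = sw \<e> (\<lambda>a b. sw a (\<lambda>c d. \<epsilon> (c * g) * (\<epsilon> (h * b) * f d)))"
    by (rule sym, rule trans[OF sw_unit1]) (intro lin_intros lform_comp[OF f], rule refl)
  also have "\<dots> = sw \<e> (\<lambda>a b. sw \<e> (\<lambda>c d. \<epsilon> (a * g) * (\<epsilon> (h * d) * f (c * b))))"
    by (rule trans[OF sw_unit2]) (intro lin_intros lform_comp[OF f], rule refl)
  also have "\<dots> = sw \<e> (\<lambda>a b. \<epsilon> (a * g) * f (es h * b))"
    by (rule sw_cong[OF refl], unfold sw_mult_left[symmetric], rule arg_cong[where f="(*) _"], rule es_f[symmetric]) (intro lin_intros lform_comp[OF f])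
  also have "\<dots> = f (es h * et g)"
    by (rule et_f[symmetric]) (intro lin_intros lform_comp[OF f])
  finally show "f (x * y) = f (y * x)" unfolding gh .
qed

section \<open>The antipode and the bases\<close>

lemma Ht_iff: "x \<in> Ht \<longleftrightarrow> et x = x"
  using et_Ht et_in[of x] by auto

lemma Hs_iff: "y \<in> Hs \<longleftrightarrow> es y = y"
  using es_Hs es_in[of y] by auto

text \<open>
  For \<open>x \<in> H\<^sub>t\<close> the coproduct of \<open>x\<close> is \<open>\<Delta>(1)\<close> with \<open>x\<close> multiplied to the first leg, from either
  side, and \<open>\<Delta>(1)\<close> is absorbed by \<open>\<Delta>(h)\<close>.  For \<open>H\<^sub>s\<close> the second leg takes this role.
\<close>

lemma sw_Ht_mult_left:
  assumes x: "x \<in> Ht" and B: "bilin B"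
  shows "sw (x * h) B = sw h (\<lambda>a b. B (x * a) b)"
proof -
  have "sw (x * h) B = sw x (\<lambda>a b. sw h (\<lambda>c d. B (a * c) (b * d)))"
    by (rule sw_mult[OF B])
  also have "\<dots> = sw \<e> (\<lambda>a b. sw h (\<lambda>c d. B ((x * a) * c) (b * d)))"
    by (rule trans[OF sw_Ht(1)[OF x]]) (intro lin_intros lform_bil1[OF B] lform_bil2[OF B], rule refl)
  also have "\<dots> = sw \<e> (\<lambda>a b. sw h (\<lambda>c d. B (x * (a * c)) (b * d)))"
    by (simp only: mult.assoc)
  also have "\<dots> = sw (\<e> * h) (\<lambda>a b. B (x * a) b)"
    by (rule sym, rule trans[OF sw_mult]) (intro lin_intros lform_bil1[OF B] lform_bil2[OF B], rule refl)
  finally show ?thesis by (simp only: unit_left)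
qed

lemma sw_Ht_mult_right:
  assumes x: "x \<in> Ht" and B: "bilin B"
  shows "sw (h * x) B = sw h (\<lambda>a b. B (a * x) b)"
proof -
  have "sw (h * x) B = sw h (\<lambda>a b. sw x (\<lambda>c d. B (a * c) (b * d)))"
    by (rule sw_mult[OF B])
  also have "\<dots> = sw h (\<lambda>a b. sw \<e> (\<lambda>c d. B (a * (c * x)) (b * d)))"
    by (rule sw_cong[OF refl], rule trans[OF sw_Ht(2)[OF x]]) (intro lin_intros lform_bil1[OF B] lform_bil2[OF B], rule refl)
  also have "\<dots> = sw h (\<lambda>a b. sw \<e> (\<lambda>c d. B ((a * c) * x) (b * d)))"
    by (simp only: mult.assoc)
  also have "\<dots> = sw (h * \<e>) (\<lambda>a b. B (a * x) b)"
    by (rule sym, rule trans[OF sw_mult]) (intro lin_intros lform_bil1[OF B] lform_bil2[OF B], rule refl)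
  finally show ?thesis by (simp only: unit_right)
qed

lemma sw_Hs_mult_left:
  assumes y: "y \<in> Hs" and B: "bilin B"
  shows "sw (y * h) B = sw h (\<lambda>a b. B a (y * b))"
proof -
  have "sw (y * h) B = sw y (\<lambda>a b. sw h (\<lambda>c d. B (a * c) (b * d)))"
    by (rule sw_mult[OF B])
  also have "\<dots> = sw \<e> (\<lambda>a b. sw h (\<lambda>c d. B (a * c) ((y * b) * d)))"
    by (rule trans[OF sw_Hs(2)[OF y]]) (intro lin_intros lform_bil1[OF B] lform_bil2[OF B], rule refl)
  also have "\<dots> = sw \<e> (\<lambda>a b. sw h (\<lambda>c d. B (a * c) (y * (b * d))))"
    by (simp only: mult.assoc)
  also have "\<dots> = sw (\<e> * h) (\<lambda>a b. B a (y * b))"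
    by (rule sym, rule trans[OF sw_mult]) (intro lin_intros lform_bil1[OF B] lform_bil2[OF B], rule refl)
  finally show ?thesis by (simp only: unit_left)
qed

lemma sw_Hs_mult_right:
  assumes y: "y \<in> Hs" and B: "bilin B"
  shows "sw (h * y) B = sw h (\<lambda>a b. B a (b * y))"
proof -
  have "sw (h * y) B = sw h (\<lambda>a b. sw y (\<lambda>c d. B (a * c) (b * d)))"
    by (rule sw_mult[OF B])
  also have "\<dots> = sw h (\<lambda>a b. sw \<e> (\<lambda>c d. B (a * c) (b * (d * y))))"
    by (rule sw_cong[OF refl], rule trans[OF sw_Hs(1)[OF y]]) (intro lin_intros lform_bil1[OF B] lform_bil2[OF B], rule refl)
  also have "\<dots> = sw h (\<lambda>a b. sw \<e> (\<lambda>c d. B (a * c) ((b * d) * y)))"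
    by (simp only: mult.assoc)
  also have "\<dots> = sw (h * \<e>) (\<lambda>a b. B a (b * y))"
    by (rule sym, rule trans[OF sw_mult]) (intro lin_intros lform_bil1[OF B] lform_bil2[OF B], rule refl)
  finally show ?thesis by (simp only: unit_right)
qed

lemma et_mult_left:
  assumes x: "x \<in> Ht" shows "et (x * h) = x * et h"
proof (rule vector_eqI)
  fix f assume f: "lform f"
  have "f (et (x * h)) = sw (x * h) (\<lambda>a b. f (a * S b))"
    by (rule sw_antipode_right[OF f, symmetric])
  also have "\<dots> = sw h (\<lambda>a b. f (x * (a * S b)))"
    by (rule trans[OF sw_Ht_mult_left[OF x]]) (intro lin_intros lform_comp[OF f], simp only: mult.assoc)
  also have "\<dots> = f (x * et h)"
    by (rule sw_antipode_right) (intro lin_intros lform_comp[OF f])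
  finally show "f (et (x * h)) = f (x * et h)" .
qed

lemma es_mult_right:
  assumes y: "y \<in> Hs" shows "es (h * y) = es h * y"
proof (rule vector_eqI)
  fix f assume f: "lform f"
  have "f (es (h * y)) = sw (h * y) (\<lambda>a b. f (S a * b))"
    by (rule sw_antipode_left[OF f, symmetric])
  also have "\<dots> = sw h (\<lambda>a b. f (S a * b * y))"
    by (rule trans[OF sw_Hs_mult_right[OF y]]) (intro lin_intros lform_comp[OF f], simp only: mult.assoc)
  also have "\<dots> = f (es h * y)"
    by (rule sw_antipode_left) (intro lin_intros lform_comp[OF f])
  finally show "f (es (h * y)) = f (es h * y)" .
qed

lemma Ht_mult: "x \<in> Ht \<Longrightarrow> x' \<in> Ht \<Longrightarrow> x * x' \<in> Ht"
  by (simp add: Ht_iff[of "x * x'"] et_mult_left et_Ht)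

lemma Hs_mult: "y \<in> Hs \<Longrightarrow> z \<in> Hs \<Longrightarrow> y * z \<in> Hs"
  by (simp add: Hs_iff[of "y * z"] es_mult_right es_Hs)

text \<open>
  The axiom \<open>S(h) = S(h\<^sub>1) h\<^sub>2 S(h\<^sub>3)\<close> with the first or the last two factors contracted to a
  counital map.
\<close>

lemma S_es:
  assumes f: "lform f" shows "f (S h) = sw h (\<lambda>a b. f (es a * S b))"
proof -
  have "f (S h) = f (sw h (\<lambda>a b. sw a (\<lambda>c d. S c * d * S b)))"
    using antipode_conv[of h] unfolding sw_def by simp
  also have "\<dots> = sw h (\<lambda>a b. sw a (\<lambda>c d. f (S c * d * S b)))"
    by (simp only: lformD[OF f])
  also have "\<dots> = sw h (\<lambda>a b. f (es a * S b))"
    by (rule sw_cong[OF refl], rule sw_antipode_left) (intro lin_intros lform_comp[OF f])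
  finally show ?thesis .
qed

lemma S_et:
  assumes f: "lform f" shows "f (S h) = sw h (\<lambda>a b. f (S a * et b))"
proof -
  have "f (S h) = f (sw h (\<lambda>a b. sw a (\<lambda>c d. S c * d * S b)))"
    using antipode_conv[of h] unfolding sw_def by simp
  also have "\<dots> = sw h (\<lambda>a b. sw a (\<lambda>c d. f (S c * d * S b)))"
    by (simp only: lformD[OF f])
  also have "\<dots> = sw h (\<lambda>a b. sw b (\<lambda>c d. f (S a * c * S d)))"
    by (rule trans[OF sw_coassoc]) (intro lin_intros lform_comp[OF f], rule refl)
  also have "\<dots> = sw h (\<lambda>a b. sw b (\<lambda>c d. f (S a * (c * S d))))"
    by (simp only: mult.assoc)
  also have "\<dots> = sw h (\<lambda>a b. f (S a * et b))"
    by (rule sw_cong[OF refl], rule sw_antipode_right) (intro lin_intros lform_comp[OF f])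
  finally show ?thesis .
qed

text \<open>
  For \<open>y \<in> H\<^sub>s\<close> the coproduct is \<open>1\<^sub>1 \<otimes> y 1\<^sub>2\<close>, and this turns \<open>S(y) = \<epsilon>\<^sub>s(y\<^sub>1) S(y\<^sub>2)\<close> into
  \<open>y\<^sub>1 S(y\<^sub>2) = \<epsilon>\<^sub>t(y)\<close>.  The case of \<open>H\<^sub>t\<close> is the mirror image.
\<close>

lemma S_Hs:
  assumes y: "y \<in> Hs" shows "S y = et y"
proof (rule vector_eqI)
  fix f assume f: "lform f"
  have "f (S y) = sw y (\<lambda>a b. f (es a * S b))" by (rule S_es[OF f])
  also have "\<dots> = sw \<e> (\<lambda>a b. f (a * S (y * b)))"
    by (rule trans[OF sw_es]) (intro lin_intros lform_comp[OF f], rule refl)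
  also have "\<dots> = sw y (\<lambda>a b. f (a * S b))"
    by (rule sym, rule trans[OF sw_Hs(2)[OF y]]) (intro lin_intros lform_comp[OF f], rule refl)
  also have "\<dots> = f (et y)" by (rule sw_antipode_right[OF f])
  finally show "f (S y) = f (et y)" .
qed

lemma S_Ht:
  assumes x: "x \<in> Ht" shows "S x = es x"
proof (rule vector_eqI)
  fix f assume f: "lform f"
  have "f (S x) = sw x (\<lambda>a b. f (S a * et b))" by (rule S_et[OF f])
  also have "\<dots> = sw \<e> (\<lambda>a b. f (S (a * x) * b))"
    by (rule trans[OF sw_et]) (intro lin_intros lform_comp[OF f], rule refl)
  also have "\<dots> = sw x (\<lambda>a b. f (S a * b))"
    by (rule sym, rule trans[OF sw_Ht(2)[OF x]]) (intro lin_intros lform_comp[OF f], rule refl)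
  also have "\<dots> = f (es x)" by (rule sw_antipode_left[OF f])
  finally show "f (S x) = f (es x)" .
qed

lemma S_Hs_in: "y \<in> Hs \<Longrightarrow> S y \<in> Ht" and S_Ht_in: "x \<in> Ht \<Longrightarrow> S x \<in> Hs"
  by (simp_all add: S_Hs S_Ht et_in es_in)

text \<open>
  \<open>\<Delta>(1)\<close> lies in \<open>H\<^sub>s \<otimes> H\<^sub>t\<close>.  As tensors are formal sums, this is expressed by inserting
  the projections \<open>\<epsilon>\<^sub>s\<close> and \<open>\<epsilon>\<^sub>t\<close>; the congruence rule below then allows one to argue about
  \<open>1\<^sub>1\<close> and \<open>1\<^sub>2\<close> as elements of the bases.
\<close>

lemma sw_one_legs:
  assumes B: "bilin B" shows "sw \<e> (\<lambda>a b. B (es a) (et b)) = sw \<e> B"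
proof -
  have "sw \<e> (\<lambda>a b. B (es a) (et b)) = sw \<e> (\<lambda>a b. B a (et (\<e> * b)))"
    by (rule trans[OF sw_es]) (intro lin_intros lform_bil1[OF B] lform_bil2[OF B], rule refl)
  also have "\<dots> = sw \<e> (\<lambda>a b. B (a * \<e>) b)"
    unfolding unit_left by (rule sw_et[OF B])
  finally show ?thesis by (simp only: unit_right)
qed

lemma sw_one_cong:
  assumes B: "bilin B" and C: "bilin C" and eq: "\<And>y x. y \<in> Hs \<Longrightarrow> x \<in> Ht \<Longrightarrow> B y x = C y x"
  shows "sw \<e> B = sw \<e> C"
  unfolding sw_one_legs[OF B, symmetric] sw_one_legs[OF C, symmetric]
  by (rule sw_cong[OF refl]) (rule eq[OF es_in et_in])

text \<open>
  Both sides are \<open>y\<^sub>1 \<otimes> \<epsilon>\<^sub>t(y\<^sub>2)\<close>, because \<open>\<epsilon>\<^sub>t(1\<^sub>2 y) = 1\<^sub>2 \<epsilon>\<^sub>t(y) = 1\<^sub>2 S(y)\<close>.  The next lemma is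
  the mirror image.
\<close>

lemma sw_one_mult_Hs:
  assumes y: "y \<in> Hs" and B: "bilin B"
  shows "sw \<e> (\<lambda>a b. B (a * y) b) = sw \<e> (\<lambda>a b. B a (b * S y))"
proof -
  have "sw \<e> (\<lambda>a b. B (a * y) b) = sw y (\<lambda>a b. B a (et b))"
    by (rule sw_et[OF B, symmetric])
  also have "\<dots> = sw \<e> (\<lambda>a b. B a (et (b * y)))"
    by (rule trans[OF sw_Hs(1)[OF y]]) (intro lin_intros lform_bil1[OF B] lform_bil2[OF B], rule refl)
  also have "\<dots> = sw \<e> (\<lambda>a b. B a (b * S y))"
    by (rule sw_one_cong) (intro lin_intros lform_bil1[OF B] lform_bil2[OF B], intro lin_intros lform_bil1[OF B] lform_bil2[OF B],
        simp add: et_mult_left S_Hs[OF y])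
  finally show ?thesis .
qed

lemma sw_one_mult_Ht:
  assumes x: "x \<in> Ht" and B: "bilin B"
  shows "sw \<e> (\<lambda>a b. B a (x * b)) = sw \<e> (\<lambda>a b. B (S x * a) b)"
proof -
  have "sw \<e> (\<lambda>a b. B a (x * b)) = sw x (\<lambda>a b. B (es a) b)"
    by (rule sw_es[OF B, symmetric])
  also have "\<dots> = sw \<e> (\<lambda>a b. B (es (x * a)) b)"
    by (rule trans[OF sw_Ht(1)[OF x]]) (intro lin_intros lform_bil1[OF B] lform_bil2[OF B], rule refl)
  also have "\<dots> = sw \<e> (\<lambda>a b. B (S x * a) b)"
    by (rule sw_one_cong) (intro lin_intros lform_bil1[OF B] lform_bil2[OF B], intro lin_intros lform_bil1[OF B] lform_bil2[OF B],
        simp add: es_mult_right S_Ht[OF x])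
  finally show ?thesis .
qed

lemma eps_S: "\<epsilon> (S h) = \<epsilon> h"
proof -
  have "\<epsilon> (S h) = sw h (\<lambda>a b. \<epsilon> (S a * et b))" by (rule S_et[OF counit_linear])
  also have "\<dots> = sw h (\<lambda>a b. \<epsilon> (S a * b))" by (simp only: eps_et)
  also have "\<dots> = \<epsilon> (es h)" by (rule sw_antipode_left[OF counit_linear])
  also have "\<dots> = \<epsilon> (es h * \<e>)" by (simp only: unit_right)
  also have "\<dots> = \<epsilon> h" by (simp only: eps_es) (simp only: unit_right)
  finally show ?thesis .
qed

lemma es_mult_Ht:
  assumes x: "x \<in> Ht" shows "es (h * x) = S x * es h"
proof (rule vector_eqI)
  fix f assume f: "lform f"
  have "f (es (h * x)) = sw \<e> (\<lambda>a b. \<epsilon> (h * (x * b)) * f a)"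
    by (simp only: es_f[OF f] mult.assoc)
  also have "\<dots> = sw \<e> (\<lambda>a b. \<epsilon> (h * b) * f (S x * a))"
    by (rule trans[OF sw_one_mult_Ht[OF x]]) (intro lin_intros lform_comp[OF f], rule refl)
  also have "\<dots> = f (S x * es h)"
    by (rule es_f[symmetric]) (intro lin_intros lform_comp[OF f])
  finally show "f (es (h * x)) = f (S x * es h)" .
qed

lemma et_mult_Hs:
  assumes y: "y \<in> Hs" shows "et (y * h) = et h * S y"
proof (rule vector_eqI)
  fix f assume f: "lform f"
  have "f (et (y * h)) = sw \<e> (\<lambda>a b. \<epsilon> ((a * y) * h) * f b)"
    by (simp only: et_f[OF f] mult.assoc)
  also have "\<dots> = sw \<e> (\<lambda>a b. \<epsilon> (a * h) * f (b * S y))"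
    by (rule trans[OF sw_one_mult_Hs[OF y]]) (intro lin_intros lform_comp[OF f], rule refl)
  also have "\<dots> = f (et h * S y)"
    by (rule et_f[symmetric]) (intro lin_intros lform_comp[OF f])
  finally show "f (et (y * h)) = f (et h * S y)" .
qed

text \<open>
  When one factor lies in a base, anti-multiplicativity of the antipode follows from the behaviour of
  the counital maps: the base element stays in one leg of the coproduct, where \<open>S_es\<close> or \<open>S_et\<close>
  turns it into a factor of a counital map.
\<close>

lemma S_mult_Ht:
  assumes x: "x \<in> Ht" shows "S (h * x) = S x * S h"
proof (rule vector_eqI)
  fix f assume f: "lform f"
  have "f (S (h * x)) = sw (h * x) (\<lambda>a b. f (es a * S b))" by (rule S_es[OF f])
  also have "\<dots> = sw h (\<lambda>a b. f (es (a * x) * S b))"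
    by (rule trans[OF sw_Ht_mult_right[OF x]]) (intro lin_intros lform_comp[OF f], rule refl)
  also have "\<dots> = sw h (\<lambda>a b. f (S x * (es a * S b)))"
    by (simp only: es_mult_Ht[OF x] mult.assoc)
  also have "\<dots> = f (S x * S h)"
    by (rule S_es[symmetric]) (intro lin_intros lform_comp[OF f])
  finally show "f (S (h * x)) = f (S x * S h)" .
qed

lemma S_mult_Hs:
  assumes y: "y \<in> Hs" shows "S (y * h) = S h * S y"
proof (rule vector_eqI)
  fix f assume f: "lform f"
  have "f (S (y * h)) = sw (y * h) (\<lambda>a b. f (S a * et b))" by (rule S_et[OF f])
  also have "\<dots> = sw h (\<lambda>a b. f (S a * et (y * b)))"
    by (rule trans[OF sw_Hs_mult_left[OF y]]) (intro lin_intros lform_comp[OF f], rule refl)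
  also have "\<dots> = sw h (\<lambda>a b. f ((S a * et b) * S y))"
    by (simp only: et_mult_Hs[OF y] mult.assoc)
  also have "\<dots> = f (S h * S y)"
    by (rule S_et[symmetric]) (intro lin_intros lform_comp[OF f])
  finally show "f (S (y * h)) = f (S h * S y)" .
qed

lemma sw_one_in_Hs:
  assumes g: "lform g" shows "sw \<e> (\<lambda>a b. g b \<cdot> a) \<in> Hs"
proof -
  have "es (sw \<e> (\<lambda>a b. g b \<cdot> a)) = sw \<e> (\<lambda>a b. g b \<cdot> a)"
  proof (rule vector_eqI)
    fix f assume f: "lform f"
    have "f (es (sw \<e> (\<lambda>a b. g b \<cdot> a))) = sw \<e> (\<lambda>a b. g b * f (es a))"
      by (simp only: lmapD[OF es_lmap] lformD[OF f])
    also have "\<dots> = sw \<e> (\<lambda>a b. g (\<e> * b) * f a)"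
      by (rule trans[OF sw_es]) (intro lin_intros lform_comp[OF f] lform_comp[OF g], rule refl)
    finally show "f (es (sw \<e> (\<lambda>a b. g b \<cdot> a))) = f (sw \<e> (\<lambda>a b. g b \<cdot> a))"
      by (simp only: unit_left lformD[OF f])
  qed
  then show ?thesis by (simp add: Hs_iff)
qed

lemma sw_one_in_Ht:
  assumes g: "lform g" shows "sw \<e> (\<lambda>a b. g a \<cdot> b) \<in> Ht"
proof -
  have "et (sw \<e> (\<lambda>a b. g a \<cdot> b)) = sw \<e> (\<lambda>a b. g a \<cdot> b)"
  proof (rule vector_eqI)
    fix f assume f: "lform f"
    have "f (et (sw \<e> (\<lambda>a b. g a \<cdot> b))) = sw \<e> (\<lambda>a b. g a * f (et b))"
      by (simp only: lmapD[OF et_lmap] lformD[OF f])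
    also have "\<dots> = sw \<e> (\<lambda>a b. g (a * \<e>) * f b)"
      by (rule trans[OF sw_et]) (intro lin_intros lform_comp[OF f] lform_comp[OF g], rule refl)
    finally show "f (et (sw \<e> (\<lambda>a b. g a \<cdot> b))) = f (sw \<e> (\<lambda>a b. g a \<cdot> b))"
      by (simp only: unit_right lformD[OF f])
  qed
  then show ?thesis by (simp add: Ht_iff)
qed

lemma ebs_in: "ebs h \<in> Hs"
  unfolding ebs_def by (rule sw_one_in_Hs) (intro lin_intros)

lemma ebt_in: "ebt h \<in> Ht"
  unfolding ebt_def by (rule sw_one_in_Ht) (intro lin_intros)

lemma et_ebs: "et (ebs h) = et h"
  by (rule vector_eqI) (simp only: et_f eps_ebs)

lemma es_ebt: "es (ebt h) = es h"
  by (rule vector_eqI) (simp only: es_f eps_ebt)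

end

text \<open>
  When \<open>S\<^sup>2 = id\<close> on the bases, the barred counital maps agree with the antipode there as well.  This
  makes \<open>1\<^sub>1 \<otimes> S(1\<^sub>2)\<close> a symmetric tensor, and the counit a trace form on \<open>H\<^sub>s\<close> for which it
  is a pair of dual bases.
\<close>

locale involutive_weak_hopf_algebra = weak_hopf_algebra H
  for H :: "('k::field, 'h::ring) weak_hopf" +
  assumes SS_Ht: "x \<in> base_t H \<Longrightarrow> antipode H (antipode H x) = x"
    and SS_Hs: "y \<in> base_s H \<Longrightarrow> antipode H (antipode H y) = y"
begin

lemma ebs_Ht: assumes x: "x \<in> Ht" shows "ebs x = S x"
proof -
  have "S (ebs x) = x" using S_Hs[OF ebs_in] et_ebs et_Ht[OF x] by simp
  then show ?thesis using SS_Hs[OF ebs_in, of x] by simp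
qed

lemma ebt_Hs: assumes y: "y \<in> Hs" shows "ebt y = S y"
proof -
  have "S (ebt y) = y" using S_Ht[OF ebt_in] es_ebt es_Hs[OF y] by simp
  then show ?thesis using SS_Ht[OF ebt_in, of y] by simp
qed

text \<open>
  Expanding \<open>S(1\<^sub>2)\<close> by \<open>\<epsilon>\<^sub>s\<close> on one side and by its barred version on the other produces the
  same double sum over two copies of \<open>\<Delta>(1)\<close>.
\<close>

lemma sw_one_sym:
  assumes B: "bilin B" shows "sw \<e> (\<lambda>a b. B a (S b)) = sw \<e> (\<lambda>a b. B (S b) a)"
proof -
  have "sw \<e> (\<lambda>a b. B a (S b)) = sw \<e> (\<lambda>a b. B a (es b))"
    by (rule sw_one_cong) (intro lin_intros lform_bil1[OF B] lform_bil2[OF B], intro lin_intros lform_bil1[OF B] lform_bil2[OF B],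
        simp add: S_Ht)
  also have "\<dots> = sw \<e> (\<lambda>a b. sw \<e> (\<lambda>c d. \<epsilon> (b * d) * B a c))"
    by (rule sw_cong[OF refl], rule es_f) (intro lin_intros lform_bil1[OF B] lform_bil2[OF B])
  also have "\<dots> = sw \<e> (\<lambda>c d. sw \<e> (\<lambda>a b. \<epsilon> (b * d) * B a c))"
    by (rule sw_swap)
  also have "\<dots> = sw \<e> (\<lambda>c d. B (ebs d) c)"
    by (rule sw_cong[OF refl], rule ebs_f[symmetric]) (intro lin_intros lform_bil1[OF B] lform_bil2[OF B])
  also have "\<dots> = sw \<e> (\<lambda>c d. B (S d) c)"
    by (rule sw_one_cong) (intro lin_intros lform_bil1[OF B] lform_bil2[OF B], intro lin_intros lform_bil1[OF B] lform_bil2[OF B],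
        simp add: ebs_Ht)
  finally show ?thesis .
qed

lemma sw_one_flip:
  assumes B: "bilin B" shows "sw \<e> B = sw \<e> (\<lambda>a b. B (S b) (S a))"
proof -
  have "sw \<e> B = sw \<e> (\<lambda>a b. B a (S (S b)))"
    by (rule sw_one_cong) (rule B, intro lin_intros lform_bil1[OF B] lform_bil2[OF B], simp add: SS_Ht)
  also have "\<dots> = sw \<e> (\<lambda>a b. B (S b) (S a))"
    by (rule sw_one_sym[of "\<lambda>a b. B a (S b)"]) (intro lin_intros lform_bil1[OF B] lform_bil2[OF B])
  finally show ?thesis .
qed

text \<open>
  The legs of \<open>1\<^sub>1 \<otimes> S(1\<^sub>2)\<close> are dual bases of \<open>H\<^sub>s\<close> for \<open>\<epsilon>\<close>, because the two sums are \<open>f\<close> of the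
  antipode of the barred \<open>\<epsilon>\<^sub>t(y)\<close> and of \<open>\<epsilon>\<^sub>t(y)\<close>, and both of these are \<open>S(y)\<close>.
\<close>

lemma Hs_reproducing:
  assumes y: "y \<in> Hs" and f: "lform f"
  shows "sw \<e> (\<lambda>a b. \<epsilon> (y * a) * f (S b)) = f y" "sw \<e> (\<lambda>a b. \<epsilon> (a * y) * f (S b)) = f y"
proof -
  have "sw \<e> (\<lambda>a b. \<epsilon> (y * a) * f (S b)) = f (S (ebt y))"
    by (rule ebt_f[symmetric]) (intro lin_intros lform_comp[OF f])
  then show "sw \<e> (\<lambda>a b. \<epsilon> (y * a) * f (S b)) = f y" by (simp add: ebt_Hs SS_Hs y)
  have "sw \<e> (\<lambda>a b. \<epsilon> (a * y) * f (S b)) = f (S (et y))"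
    by (rule et_f[symmetric]) (intro lin_intros lform_comp[OF f])
  then show "sw \<e> (\<lambda>a b. \<epsilon> (a * y) * f (S b)) = f y" by (simp add: S_Hs[symmetric] SS_Hs y)
qed

text \<open>
  The products \<open>(f \<otimes> g)\<Delta>(1)\<close> and \<open>\<Delta>(1)(f \<otimes> g)\<close> in \<open>H\<^sup>* \<otimes> H\<^sup>*\<close>, which occur in the definition of
  group-like elements, evaluated with a single copy of \<open>\<Delta>(1) \<in> H \<otimes> H\<close>.
\<close>

lemma conv_tensor_right:
  assumes f: "lform f" and g: "lform g"
  shows "sw h (\<lambda>a b. sw k (\<lambda>c d. f a * g c * \<epsilon> (b * d))) = sw \<e> (\<lambda>p q. f (h * p) * g (S q * k))"
proof -
  have "sw h (\<lambda>a b. sw k (\<lambda>c d. f a * g c * \<epsilon> (b * d)))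
      = sw h (\<lambda>a b. sw k (\<lambda>c d. f a * g c * \<epsilon> (ebt b * d)))"
    by (simp only: eps_ebt)
  also have "\<dots> = sw \<e> (\<lambda>p q. sw k (\<lambda>c d. f (h * p) * g c * \<epsilon> (q * d)))"
    by (rule trans[OF sw_ebt]) (intro lin_intros lform_comp[OF f] lform_comp[OF g], rule refl)
  also have "\<dots> = sw \<e> (\<lambda>p q. f (h * p) * g (S q * k))"
  proof (rule sw_one_cong)
    fix p q assume p: "p \<in> Hs" and q: "q \<in> Ht"
    have "sw k (\<lambda>c d. f (h * p) * g c * \<epsilon> (q * d)) = sw k (\<lambda>c d. f (h * p) * g c * \<epsilon> (S q * d))"
      using eps_es[of q] by (simp only: S_Ht[OF q])
    also have "\<dots> = sw (S q * k) (\<lambda>c d. f (h * p) * g c * \<epsilon> d)"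
      by (rule sym, rule trans[OF sw_Hs_mult_left[OF S_Ht_in[OF q]]]) (intro lin_intros lform_comp[OF f] lform_comp[OF g], rule refl)
    also have "\<dots> = f (h * p) * g (S q * k)"
      by (rule sw_counit_right) (intro lin_intros lform_comp[OF g])
    finally show "sw k (\<lambda>c d. f (h * p) * g c * \<epsilon> (q * d)) = f (h * p) * g (S q * k)" .
  qed (intro lin_intros lform_comp[OF f] lform_comp[OF g])+
  finally show ?thesis .
qed

lemma conv_tensor_left:
  assumes f: "lform f" and g: "lform g"
  shows "sw h (\<lambda>a b. sw k (\<lambda>c d. \<epsilon> (a * c) * (f b * g d))) = sw \<e> (\<lambda>p q. f (h * q) * g (S p * k))"
proof -
  have "sw h (\<lambda>a b. sw k (\<lambda>c d. \<epsilon> (a * c) * (f b * g d)))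
      = sw h (\<lambda>a b. sw k (\<lambda>c d. \<epsilon> (es a * c) * (f b * g d)))"
    by (simp only: eps_es)
  also have "\<dots> = sw \<e> (\<lambda>p q. sw k (\<lambda>c d. \<epsilon> (p * c) * (f (h * q) * g d)))"
    by (rule trans[OF sw_es]) (intro lin_intros lform_comp[OF f] lform_comp[OF g], rule refl)
  also have "\<dots> = sw \<e> (\<lambda>p q. f (h * q) * g (S p * k))"
  proof (rule sw_one_cong)
    fix p q assume p: "p \<in> Hs" and q: "q \<in> Ht"
    have "sw k (\<lambda>c d. \<epsilon> (p * c) * (f (h * q) * g d)) = sw k (\<lambda>c d. \<epsilon> (S p * c) * (f (h * q) * g d))"
      using eps_ebt[of p] by (simp only: ebt_Hs[OF p])
    also have "\<dots> = sw (S p * k) (\<lambda>c d. \<epsilon> c * (f (h * q) * g d))"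
      by (rule sym, rule trans[OF sw_Ht_mult_left[OF S_Hs_in[OF p]]]) (intro lin_intros lform_comp[OF f] lform_comp[OF g], rule refl)
    also have "\<dots> = f (h * q) * g (S p * k)"
      by (rule sw_counit_left) (intro lin_intros lform_comp[OF g])
    finally show "sw k (\<lambda>c d. \<epsilon> (p * c) * (f (h * q) * g d)) = f (h * q) * g (S p * k)" .
  qed (intro lin_intros lform_comp[OF f] lform_comp[OF g])+
  finally show ?thesis .
qed

end

context weak_hopf_algebra begin

section \<open>Trivial group-like elements of the dual\<close>

lemma dual_mult_sw: "dual_mult H f g h = sw h (\<lambda>a b. f a * g b)"
  unfolding dual_mult_def sw_def ..

lemma dual_tensor_mult_sw:
  "dual_tensor_mult H A B h g = sw h (\<lambda>a b. sw g (\<lambda>c d. A a c * B b d))"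
  unfolding dual_tensor_mult_def sw_def ..

lemma dual_space_iff: "f \<in> dual_space H \<longleftrightarrow> lform f"
  unfolding dual_space_def by simp

lemma S_one: "S \<e> = \<e>"
  by (simp add: S_Hs[OF one_Hs] et_one)

text \<open>
  \<open>x \<mapsto> xi x\<close> identifies \<open>H\<^sub>t\<close> with the source base of the dual, compatibly with multiplication.
\<close>

definition xi :: "'h \<Rightarrow> 'h \<Rightarrow> 'k" where "xi x = (\<lambda>h. \<epsilon> (h * x))"

lemma xi_lform: "lform (xi x)"
  unfolding xi_def by (intro lin_intros)

lemma xi_inj:
  assumes x: "x \<in> Ht" and x': "x' \<in> Ht" and eq: "xi x = xi x'" shows "x = x'"
proof -
  have "\<epsilon> (h * x) = \<epsilon> (h * x')" for h using fun_cong[OF eq] unfolding xi_def .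
  then have "et x = et x'" by (simp only: et_alt)
  then show ?thesis using et_Ht x x' by simp
qed

text \<open>
  Convolution with \<open>h \<mapsto> \<epsilon>(x h x')\<close> substitutes \<open>x h x'\<close> for the argument, because
  \<open>x h\<^sub>1 x' \<otimes> h\<^sub>2 = \<Delta>(x h x')\<close>.
\<close>

lemma conv_twist_left:
  assumes x: "x \<in> Ht" and x': "x' \<in> Ht" and g: "lform g"
  shows "sw h (\<lambda>a b. \<epsilon> (x * a * x') * g b) = g (x * h * x')"
proof -
  have "sw h (\<lambda>a b. \<epsilon> (x * a * x') * g b) = sw (x * h) (\<lambda>a b. \<epsilon> (a * x') * g b)"
    by (rule sym, rule trans[OF sw_Ht_mult_left[OF x]]) (intro lin_intros lform_comp[OF g], rule refl)
  also have "\<dots> = sw (x * h * x') (\<lambda>a b. \<epsilon> a * g b)"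
    by (rule sym, rule trans[OF sw_Ht_mult_right[OF x']]) (intro lin_intros lform_comp[OF g], rule refl)
  also have "\<dots> = g (x * h * x')" by (rule sw_counit_left[OF g])
  finally show ?thesis .
qed

lemma conv_twist_right:
  assumes y: "y \<in> Hs" and y': "y' \<in> Hs" and g: "lform g"
  shows "sw h (\<lambda>a b. g a * \<epsilon> (y * b * y')) = g (y * h * y')"
proof -
  have "sw h (\<lambda>a b. g a * \<epsilon> (y * b * y')) = sw (y * h) (\<lambda>a b. g a * \<epsilon> (b * y'))"
    by (rule sym, rule trans[OF sw_Hs_mult_left[OF y]]) (intro lin_intros lform_comp[OF g], rule refl)
  also have "\<dots> = sw (y * h * y') (\<lambda>a b. g a * \<epsilon> b)"
    by (rule sym, rule trans[OF sw_Hs_mult_right[OF y']]) (intro lin_intros lform_comp[OF g], rule refl)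
  also have "\<dots> = g (y * h * y')" by (rule sw_counit_right[OF g])
  finally show ?thesis .
qed

end

context involutive_weak_hopf_algebra begin

lemma xi_mult:
  assumes x: "x \<in> Ht" and g: "lform g"
  shows "dual_mult H (xi x) g h = g (h * x)"
    "dual_mult H g (xi x) h = g (h * S x)"
proof -
  show "dual_mult H (xi x) g h = g (h * x)"
    using conv_twist_left[OF one_Ht x g, of h] by (simp only: dual_mult_sw xi_def unit_left)
  have "dual_mult H g (xi x) h = sw h (\<lambda>a b. g a * \<epsilon> (b * ebs x))"
    by (simp only: dual_mult_sw xi_def eps_ebs)
  then show "dual_mult H g (xi x) h = g (h * S x)"
    using conv_twist_right[OF one_Hs S_Ht_in[OF x] g, of h] by (simp only: ebs_Ht[OF x] unit_left)
qed

lemma xi_antipode: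
  assumes x: "x \<in> Ht" shows "dual_antipode H (xi x) = (\<lambda>h. \<epsilon> (x * h))"
proof
  fix h
  have "\<epsilon> (S h * x) = \<epsilon> (S h * S (S x))" by (simp only: SS_Ht[OF x])
  also have "\<dots> = \<epsilon> (S (S x * h))" by (simp only: S_mult_Hs[OF S_Ht_in[OF x]])
  also have "\<dots> = \<epsilon> (ebt (S x) * h)" by (simp only: eps_S eps_ebt)
  also have "\<dots> = \<epsilon> (x * h)" by (simp only: ebt_Hs[OF S_Ht_in[OF x]] SS_Ht[OF x])
  finally show "dual_antipode H (xi x) h = \<epsilon> (x * h)" unfolding dual_antipode_def xi_def .
qed

lemma dual_base_s_eq: "dual_base_s H = xi ` Ht"
proof -
  have sw: "dual_eps_s H f h = sw \<e> (\<lambda>a b. f a * \<epsilon> (h * b))" for f h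
    unfolding dual_eps_s_def dual_mult_sw dual_comult_def ..
  have 1: "dual_eps_s H f = xi (sw \<e> (\<lambda>a b. f a \<cdot> b))" for f
    unfolding fun_eq_iff sw xi_def by (simp only: push mult_scal_right eps_lin simp_thms)
  have 2: "sw \<e> (\<lambda>a b. \<epsilon> (x * a) \<cdot> b) = x" if "x \<in> Ht" for x
    using ebt_Ht[OF that] unfolding ebt_def .
  have "xi x \<in> dual_base_s H" if x: "x \<in> Ht" for x
  proof -
    have "xi x = dual_eps_s H (\<lambda>h. \<epsilon> (x * h))" unfolding 1 2[OF x] ..
    moreover have "lform (\<lambda>h. \<epsilon> (x * h))" by (intro lin_intros)
    ultimately show ?thesis by (simp add: dual_base_s_def dual_space_iff)
  qed
  moreover have "f \<in> xi ` Ht" if fb: "f \<in> dual_base_s H" for f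
  proof -
    obtain g where "lform g" "f = dual_eps_s H g" using fb by (auto simp: dual_base_s_def dual_space_iff)
    then show ?thesis using sw_one_in_Ht[of g] unfolding 1 by simp
  qed
  ultimately show ?thesis by blast
qed

text \<open>For inverse elements \<open>x\<close>, \<open>x'\<close> of \<open>H\<^sub>t\<close> this is \<open>S(\<xi>) \<xi>\<^sup>-\<^sup>1\<close> with \<open>\<xi> = xi x\<close>.\<close>

definition twist :: "'h \<Rightarrow> 'h \<Rightarrow> 'h \<Rightarrow> 'k" where "twist x x' = (\<lambda>h. \<epsilon> (x * h * x'))"

lemma twist_lform: "lform (twist x x')"
  unfolding twist_def by (intro lin_intros)

lemma twist_mult: "x \<in> Ht \<Longrightarrow> x' \<in> Ht \<Longrightarrow> lform g \<Longrightarrow> dual_mult H (twist x x') g = (\<lambda>h. g (x * h * x'))"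
  unfolding fun_eq_iff dual_mult_sw twist_def by (simp add: conv_twist_left)

lemma inverse_cancel: "u * v = \<e> \<Longrightarrow> u * (v * h) = h"
  by (metis mult.assoc unit_left)

lemma twist_inverse:
  assumes x: "x \<in> Ht" and x': "x' \<in> Ht" and inv: "x * x' = \<e>" "x' * x = \<e>"
  shows "dual_inverse H (twist x x') (twist x' x)"
proof -
  have "dual_mult H (twist x x') (twist x' x) = counit H" "dual_mult H (twist x' x) (twist x x') = counit H"
    unfolding twist_mult[OF x x' twist_lform] twist_mult[OF x' x twist_lform]
    by (simp_all add: twist_def fun_eq_iff mult.assoc inverse_cancel inv unit_right)
  then show ?thesis unfolding dual_inverse_def dual_space_iff by (simp add: twist_lform)
qed

text \<open>
  Both identities reduce to \<open>\<epsilon>(x h x' x k x') = \<epsilon>(x h k x')\<close>.  For the product with \<open>\<Delta>(1)\<close> on the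
  left the same functional has to be written with the elements \<open>S(x)\<close>, \<open>S(x')\<close> of \<open>H\<^sub>s\<close>, which
  pass through the second leg of a coproduct.
\<close>

lemma twist_grouplike:
  assumes x: "x \<in> Ht" and x': "x' \<in> Ht" and inv: "x * x' = \<e>" "x' * x = \<e>"
  shows "dual_grouplike H (twist x x')"
  unfolding dual_grouplike_def
proof (intro conjI ext)
  show "\<exists>\<gamma>'. dual_inverse H (twist x x') \<gamma>'" using twist_inverse[OF assms] by blast
  fix h k
  have "dual_tensor_mult H (dual_tensor (twist x x') (twist x x')) (dual_comult \<epsilon>) h k
      = sw h (\<lambda>a b. \<epsilon> (x * a * x') * sw k (\<lambda>c d. \<epsilon> (x * c * x') * \<epsilon> (b * d)))"
    by (simp only: dual_tensor_mult_sw dual_tensor_def dual_comult_def twist_def sw_mult_left mult.assoc)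
  also have "\<dots> = sw h (\<lambda>a b. \<epsilon> (x * a * x') * \<epsilon> (b * (x * k * x')))"
    by (rule sw_cong[OF refl], rule arg_cong[where f="(*) _"], rule conv_twist_left[OF x x']) (intro lin_intros)
  also have "\<dots> = \<epsilon> ((x * h * x') * (x * k * x'))"
    by (rule conv_twist_left[OF x x']) (intro lin_intros)
  also have "\<dots> = dual_comult (twist x x') h k"
    by (simp add: dual_comult_def twist_def mult.assoc inverse_cancel[OF inv(2)])
  finally show "dual_comult (twist x x') h k
    = dual_tensor_mult H (dual_tensor (twist x x') (twist x x')) (dual_comult \<epsilon>) h k" by simp
  define y y' where "y = S x" and "y' = S x'"
  have y: "y \<in> Hs" "y' \<in> Hs" unfolding y_def y'_def by (simp_all add: S_Ht_in x x')
  have yy: "y' * y = \<e>" unfolding y_def y'_def S_mult_Ht[OF x', symmetric] by (simp add: inv S_one)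
  have tw: "twist x x' = (\<lambda>h. \<epsilon> (y * h * y'))"
  proof
    fix h
    have "\<epsilon> (x * h * x') = \<epsilon> (x * h * ebs x')" by (simp only: eps_ebs)
    also have "\<dots> = \<epsilon> (ebt y * (h * y'))"
      unfolding ebs_Ht[OF x'] ebt_Hs[OF y(1)] by (simp only: y_def y'_def SS_Ht[OF x] mult.assoc)
    also have "\<dots> = \<epsilon> (y * h * y')" by (simp only: eps_ebt mult.assoc)
    finally show "twist x x' h = \<epsilon> (y * h * y')" unfolding twist_def .
  qed
  have "dual_tensor_mult H (dual_comult \<epsilon>) (dual_tensor (twist x x') (twist x x')) h k
      = sw h (\<lambda>a b. sw k (\<lambda>c d. \<epsilon> (a * c) * \<epsilon> (y * d * y')) * \<epsilon> (y * b * y'))"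
    by (simp only: dual_tensor_mult_sw dual_tensor_def dual_comult_def tw sw_mult_right)
      (simp only: mult.commute mult.left_commute)
  also have "\<dots> = sw h (\<lambda>a b. \<epsilon> (a * (y * k * y')) * \<epsilon> (y * b * y'))"
    by (rule sw_cong[OF refl], rule arg_cong[where f="\<lambda>z. z * _"], rule conv_twist_right[OF y]) (intro lin_intros)
  also have "\<dots> = \<epsilon> ((y * h * y') * (y * k * y'))"
    by (rule conv_twist_right[OF y]) (intro lin_intros)
  also have "\<dots> = dual_comult (twist x x') h k"
    by (simp add: dual_comult_def tw mult.assoc inverse_cancel[OF yy])
  finally show "dual_comult (twist x x') h k
    = dual_tensor_mult H (dual_comult \<epsilon>) (dual_tensor (twist x x') (twist x x')) h k" by simp
qed

text \<open>
  The point is that an inverse of \<open>xi w\<close> in the dual is automatically of the form \<open>xi w'\<close>.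
\<close>

lemma trivial_grouplikes_iff:
  "g \<in> trivial_grouplikes H \<longleftrightarrow>
     (\<exists>x\<in>Ht. \<exists>x'\<in>Ht. x * x' = \<e> \<and> x' * x = \<e> \<and> g = twist x x')"
proof
  assume "g \<in> trivial_grouplikes H"
  then obtain w k where w: "w \<in> Ht" and inv: "dual_inverse H (xi w) k"
    and g: "g = dual_mult H (dual_antipode H (xi w)) k"
    unfolding trivial_grouplikes_def dual_base_s_eq by blast
  have k: "lform k" using inv unfolding dual_inverse_def dual_space_iff by simp
  have 1: "k (h * w) = \<epsilon> h" for h
    using inv xi_mult(1)[OF w k] unfolding dual_inverse_def by metis
  have 2: "k (h * S w) = \<epsilon> h" for h
    using inv xi_mult(2)[OF w k] unfolding dual_inverse_def by metis
  \<comment> \<open>The only candidate: if \<open>k = xi w'\<close>, then \<open>k(1\<^sub>1) 1\<^sub>2 = \<epsilon>(1\<^sub>1 w') 1\<^sub>2 = \<epsilon>\<^sub>t(w') = w'\<close>.\<close>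
  define w' where "w' = sw \<e> (\<lambda>a b. k a \<cdot> b)"
  have w': "w' \<in> Ht" unfolding w'_def by (rule sw_one_in_Ht[OF k])
  have w'w: "w' * w = \<e>"
  proof (rule vector_eqI)
    fix f assume f: "lform f"
    have "f (w' * w) = sw \<e> (\<lambda>a b. k a * f (b * S (S w)))"
      unfolding w'_def by (simp only: push mult_scal_left lformD[OF f] SS_Ht[OF w])
    also have "\<dots> = sw \<e> (\<lambda>a b. k (a * S w) * f b)"
      by (rule sym, rule trans[OF sw_one_mult_Hs[OF S_Ht_in[OF w]]]) (intro lin_intros lform_comp[OF f] lform_comp[OF k], rule refl)
    also have "\<dots> = f \<e>" unfolding 2 by (rule sw_counit_left[OF f])
    finally show "f (w' * w) = f \<e>" .
  qed
  have kw': "k = xi w'"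
  proof
    fix h
    have "k h = k ((h * w') * w)" by (simp only: mult.assoc w'w unit_right)
    then show "k h = xi w' h" unfolding 1 xi_def .
  qed
  have "xi (w * w') = xi \<e>"
    unfolding xi_def fun_eq_iff using 1 unfolding kw' xi_def by (simp add: mult.assoc unit_right)
  then have ww': "w * w' = \<e>" by (rule xi_inj[OF Ht_mult[OF w w'] one_Ht])
  have "g = twist w w'"
  proof
    fix h
    show "g h = twist w w' h"
      using conv_twist_left[OF w one_Ht k, of h]
      unfolding g dual_mult_sw xi_antipode[OF w] twist_def unit_right by (simp only: kw' xi_def)
  qed
  then show "\<exists>x\<in>Ht. \<exists>x'\<in>Ht. x * x' = \<e> \<and> x' * x = \<e> \<and> g = twist x x'"
    using w w' ww' w'w by blast
next
  assume "\<exists>x\<in>Ht. \<exists>x'\<in>Ht. x * x' = \<e> \<and> x' * x = \<e> \<and> g = twist x x'"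
  then obtain x x' where x: "x \<in> Ht" and x': "x' \<in> Ht" and inv: "x * x' = \<e>" "x' * x = \<e>"
    and g: "g = twist x x'" by blast
  have "dual_mult H (xi x) (xi x') = counit H" "dual_mult H (xi x') (xi x) = counit H"
    unfolding fun_eq_iff xi_mult(1)[OF x xi_lform] xi_mult(1)[OF x' xi_lform]
    by (simp_all add: xi_def mult.assoc inv unit_right)
  then have "dual_inverse H (xi x) (xi x')"
    unfolding dual_inverse_def dual_space_iff by (simp add: xi_lform)
  moreover have "g = dual_mult H (dual_antipode H (xi x)) (xi x')"
  proof
    fix h
    show "g h = dual_mult H (dual_antipode H (xi x)) (xi x') h"
      using conv_twist_left[OF x one_Ht xi_lform, of h x']
      unfolding g dual_mult_sw xi_antipode[OF x] twist_def unit_right by (simp only: xi_def)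
  qed
  moreover have "dual_grouplike H g" unfolding g by (rule twist_grouplike[OF x x' inv])
  ultimately show "g \<in> trivial_grouplikes H"
    unfolding trivial_grouplikes_def dual_base_s_eq using x by blast
qed

lemma counit_grouplike: "dual_grouplike H \<epsilon>"
proof -
  have "twist \<e> \<e> = \<epsilon>" unfolding twist_def by (simp add: unit_left unit_right)
  then show ?thesis using twist_grouplike[OF one_Ht one_Ht] by (simp add: unit_left)
qed

text \<open>
  The identity for \<open>\<Delta>(g)\<close> at \<open>(h, 1)\<close> shows that \<open>g = g * xi w\<close> with \<open>w = g(1\<^sub>1) 1\<^sub>2\<close>.  Cancelling
  \<open>g\<close> gives \<open>w = 1\<close>, which says that \<open>g\<close> and \<open>\<epsilon>\<close> agree on the first legs of \<open>\<Delta>(1)\<close>.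
\<close>

lemma grouplike_on_Hs:
  assumes g: "dual_grouplike H g" and y: "y \<in> Hs"
  shows "g y = \<epsilon> y"
proof -
  obtain g' where inv: "dual_inverse H g g'" using g unfolding dual_grouplike_def by blast
  then have lg: "lform g" "lform g'" and gg: "dual_mult H g' g = \<epsilon>"
    unfolding dual_inverse_def dual_space_iff by auto
  define w where "w = sw \<e> (\<lambda>a b. g a \<cdot> b)"
  have w: "w \<in> Ht" unfolding w_def by (rule sw_one_in_Ht[OF lg(1)])
  have eps_w: "\<epsilon> (h * w) = sw \<e> (\<lambda>a b. g a * \<epsilon> (h * b))" for h
    unfolding w_def by (simp only: push mult_scal_right eps_lin)
  have 1: "g h = g (h * S w)" for h
  proof -
    have "g h = dual_comult g h \<e>" unfolding dual_comult_def by (simp only: unit_right)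
    also have "\<dots> = dual_tensor_mult H (dual_tensor g g) (dual_comult \<epsilon>) h \<e>"
      using g unfolding dual_grouplike_def by metis
    also have "\<dots> = sw h (\<lambda>a b. g a * \<epsilon> (b * w))"
      unfolding eps_w by (simp only: dual_tensor_mult_sw dual_tensor_def dual_comult_def sw_mult_left mult.assoc)
    also have "\<dots> = g (h * S w)" using xi_mult(2)[OF w lg(1), of h] unfolding dual_mult_sw xi_def .
    finally show ?thesis .
  qed
  have "\<epsilon> h = \<epsilon> (h * w)" for h
  proof -
    have "\<epsilon> h = sw h (\<lambda>a b. g' a * g b)" using fun_cong[OF gg, of h] unfolding dual_mult_sw by simp
    also have "\<dots> = sw h (\<lambda>a b. g' a * g (b * S w))" using 1 by simp
    also have "\<dots> = sw (h * S w) (\<lambda>a b. g' a * g b)"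
      by (rule sym, rule trans[OF sw_Hs_mult_right[OF S_Ht_in[OF w]]]) (intro lin_intros lform_comp[OF lg(1)] lform_comp[OF lg(2)], rule refl)
    also have "\<dots> = \<epsilon> (h * ebs w)"
      using fun_cong[OF gg, of "h * S w"] unfolding dual_mult_sw ebs_Ht[OF w] .
    finally show ?thesis by (simp only: eps_ebs)
  qed
  then have "xi w = xi \<e>" unfolding xi_def by (simp add: unit_right)
  then have we: "w = \<e>" by (rule xi_inj[OF w one_Ht])
  have "g y = sw \<e> (\<lambda>a b. \<epsilon> (y * b) * g a)"
    using es_f[OF lg(1), of y] unfolding es_Hs[OF y] .
  also have "\<dots> = \<epsilon> (y * w)" unfolding eps_w by (simp only: mult.commute)
  finally show ?thesis by (simp add: we unit_right)
qed

end

context weak_hopf_algebra begin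

section \<open>Left integrals\<close>

lemma sw_diff_fun: "sw h (\<lambda>a b. f a b - g a b) = sw h f - sw h g" for f :: "'h \<Rightarrow> 'h \<Rightarrow> 'v::ab_group_add"
  using sw_add_fun[of h "\<lambda>a b. f a b - g a b" g] by simp

lemma left_integral_iff: "t \<in> left_integrals H \<longleftrightarrow> (\<forall>h. h * t = et h * t)"
  unfolding left_integrals_def by simp

lemma left_integral_mult: "t \<in> left_integrals H \<Longrightarrow> t * h \<in> left_integrals H"
  unfolding left_integral_iff by (simp flip: mult.assoc)

lemma left_integral_diff: "t \<in> left_integrals H \<Longrightarrow> u \<in> left_integrals H \<Longrightarrow> t - u \<in> left_integrals H"
  unfolding left_integral_iff by (simp add: right_diff_distrib)

text \<open>
  \<open>t\<^sub>1 \<otimes> h t\<^sub>2 = S(h) t\<^sub>1 \<otimes> t\<^sub>2\<close> for a left integral \<open>t\<close>: both sides equal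
  \<open>S(h\<^sub>1) (h\<^sub>2 t)\<^sub>1 \<otimes> (h\<^sub>2 t)\<^sub>2\<close> up to reassociating the three legs of \<open>h\<close>, since
  \<open>h\<^sub>2 t = \<epsilon>\<^sub>t(h\<^sub>2) t\<close> and \<open>S(h\<^sub>1) h\<^sub>2 = \<epsilon>\<^sub>s(h)\<close> is absorbed by \<open>\<Delta>(t) = \<Delta>(1 t)\<close>.
\<close>

lemma left_integral_shift:
  assumes t: "t \<in> left_integrals H" and B: "bilin B"
  shows "sw t (\<lambda>a b. B a (h * b)) = sw t (\<lambda>a b. B (S h * a) b)"
proof -
  have l1: "lform (\<lambda>v. sw t (\<lambda>a b. B (v * a) b))"
    by (intro lin_intros lform_bil1[OF B] lform_bil2[OF B])
  have "sw t (\<lambda>a b. B (S h * a) b) = sw h (\<lambda>p q. sw t (\<lambda>a b. B (S p * et q * a) b))"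
    by (rule S_et[OF l1])
  also have "\<dots> = sw h (\<lambda>p q. sw (et q * t) (\<lambda>a b. B (S p * a) b))"
    unfolding mult.assoc
    by (rule sw_cong[OF refl], rule sym, rule sw_Ht_mult_left[OF et_in]) (intro lin_intros lform_bil1[OF B] lform_bil2[OF B])
  also have "\<dots> = sw h (\<lambda>p q. sw (q * t) (\<lambda>a b. B (S p * a) b))"
    using t unfolding left_integral_iff by simp
  also have "\<dots> = sw h (\<lambda>p q. sw q (\<lambda>c d. sw t (\<lambda>a b. B (S p * (c * a)) (d * b))))"
    by (rule sw_cong[OF refl], rule sw_mult) (intro lin_intros lform_bil1[OF B] lform_bil2[OF B])
  also have "\<dots> = sw h (\<lambda>p q. sw p (\<lambda>c d. sw t (\<lambda>a b. B (S c * (d * a)) (q * b))))"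
    by (rule sym, rule trans[OF sw_coassoc]) (intro lin_intros lform_bil1[OF B] lform_bil2[OF B], rule refl)
  also have "\<dots> = sw h (\<lambda>p q. sw p (\<lambda>c d. sw t (\<lambda>a b. B ((S c * d) * a) (q * b))))"
    by (simp only: mult.assoc)
  also have "\<dots> = sw h (\<lambda>p q. sw t (\<lambda>a b. B (es p * a) (q * b)))"
    by (rule sw_cong[OF refl], rule sw_antipode_left) (intro lin_intros lform_bil1[OF B] lform_bil2[OF B])
  also have "\<dots> = sw \<e> (\<lambda>p q. sw t (\<lambda>a b. B (p * a) (h * q * b)))"
    by (rule trans[OF sw_es]) (intro lin_intros lform_bil1[OF B] lform_bil2[OF B], rule refl)
  also have "\<dots> = sw (\<e> * t) (\<lambda>a b. B a (h * b))"
    unfolding mult.assoc by (rule sym, rule trans[OF sw_mult]) (intro lin_intros lform_bil1[OF B] lform_bil2[OF B], rule refl)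
  finally show ?thesis by (simp only: unit_left)
qed

lemma subspace_functional_image:
  assumes add: "\<And>f g. Q (\<lambda>h. f h + g h) = Q f + Q g" and scal: "\<And>c f. Q (\<lambda>h. c * f h) = c \<cdot> Q f"
  shows "vs.subspace (Q ` {f. lform f})"
  unfolding vs.subspace_def
proof (intro conjI ballI allI)
  have "Q (\<lambda>h. 0 * 0) = 0" by (simp only: scal[of 0 "\<lambda>h. 0"] vs.scale_zero_left)
  moreover have "lform (\<lambda>h. 0 * 0)" unfolding lform_iff by simp
  ultimately show "0 \<in> Q ` {f. lform f}" by (metis (mono_tags) imageI mem_Collect_eq)
next
  fix x y assume "x \<in> Q ` {f. lform f}" "y \<in> Q ` {f. lform f}"
  then obtain f g where fg: "lform f" "x = Q f" "lform g" "y = Q g" by auto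
  have "lform (\<lambda>h. f h + g h)" unfolding lform_iff lformD[OF fg(1)] lformD[OF fg(3)]
    by (auto simp: distrib_left)
  then show "x + y \<in> Q ` {f. lform f}" unfolding fg(2,4) add[symmetric] by blast
next
  fix c x assume "x \<in> Q ` {f. lform f}"
  then obtain f where f: "lform f" "x = Q f" by auto
  then show "c \<cdot> x \<in> Q ` {f. lform f}" unfolding f(2) scal[symmetric] using lform_mult_left[OF f(1)] by blast
qed

lemma nondegenerateD:
  assumes "nondegenerate H t"
  shows "lform f \<Longrightarrow> (\<And>g. lform g \<Longrightarrow> sw t (\<lambda>a b. f a * g b) = 0) \<Longrightarrow> f = (\<lambda>_. 0)"
    "lform f \<Longrightarrow> (\<And>g. lform g \<Longrightarrow> sw t (\<lambda>a b. g a * f b) = 0) \<Longrightarrow> f = (\<lambda>_. 0)"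
  using assms unfolding nondegenerate_def dual_mult_sw Ball_def dual_space_iff by simp_all

text \<open>
  Non-degeneracy of \<open>t\<close> provides functionals with \<open>t\<^sub>1 \<phi>(t\<^sub>2) = 1\<close> and \<open>\<psi>(t\<^sub>1) t\<^sub>2 = 1\<close>.  The
  elements \<open>t\<^sub>1 \<phi>(t\<^sub>2)\<close> form a subspace; a functional that vanishes on it but not at \<open>1\<close> would
  lie in the kernel of the form defined by \<open>t\<close>.
\<close>

lemma dual_functional_right:
  assumes nd: "nondegenerate H t"
  obtains phi where "lform phi" "\<And>f. lform f \<Longrightarrow> sw t (\<lambda>a b. f a * phi b) = f \<e>"
proof -
  define Q where "Q g = sw t (\<lambda>a b. g b \<cdot> a)" for g
  have Q: "f (Q g) = sw t (\<lambda>a b. f a * g b)" if "lform f" for f g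
    unfolding Q_def by (simp only: lformD[OF that] mult.commute)
  have sub: "vs.subspace (Q ` {f. lform f})"
    by (rule subspace_functional_image)
      (simp_all only: Q_def vs.scale_left_distrib sw_add_fun vs.scale_scale[symmetric] sw_scale_left[symmetric])
  have "\<e> \<in> Q ` {f. lform f}"
  proof (rule ccontr)
    assume "\<e> \<notin> Q ` {f. lform f}"
    then obtain f where f: "lform f" "\<And>u. u \<in> Q ` {f. lform f} \<Longrightarrow> f u = 0" "f \<e> = 1"
      by (rule functional_separating_subspace[OF sub]) blast
    have "f = (\<lambda>_. 0)"
    proof (rule nondegenerateD(1)[OF nd f(1)])
      fix g assume "lform g"
      then show "sw t (\<lambda>a b. f a * g b) = 0" unfolding Q[OF f(1), symmetric] by (intro f(2)) blast
    qed
    then show False using f(3) by simp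
  qed
  then obtain phi where phi: "lform phi" "\<e> = Q phi" by auto
  show thesis by (rule that[OF phi(1)]) (simp only: Q[symmetric] phi(2)[symmetric])
qed

lemma dual_functional_left:
  assumes nd: "nondegenerate H t"
  obtains psi where "lform psi" "\<And>f. lform f \<Longrightarrow> sw t (\<lambda>a b. psi a * f b) = f \<e>"
proof -
  define Q where "Q g = sw t (\<lambda>a b. g a \<cdot> b)" for g
  have Q: "f (Q g) = sw t (\<lambda>a b. g a * f b)" if "lform f" for f g
    unfolding Q_def by (simp only: lformD[OF that])
  have sub: "vs.subspace (Q ` {f. lform f})"
    by (rule subspace_functional_image)
      (simp_all only: Q_def vs.scale_left_distrib sw_add_fun vs.scale_scale[symmetric] sw_scale_left[symmetric])
  have "\<e> \<in> Q ` {f. lform f}"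
  proof (rule ccontr)
    assume "\<e> \<notin> Q ` {f. lform f}"
    then obtain f where f: "lform f" "\<And>u. u \<in> Q ` {f. lform f} \<Longrightarrow> f u = 0" "f \<e> = 1"
      by (rule functional_separating_subspace[OF sub]) blast
    have "f = (\<lambda>_. 0)"
    proof (rule nondegenerateD(2)[OF nd f(1)])
      fix g assume "lform g"
      then show "sw t (\<lambda>a b. g a * f b) = 0" unfolding Q[OF f(1), symmetric] by (intro f(2)) blast
    qed
    then show False using f(3) by simp
  qed
  then obtain psi where psi: "lform psi" "\<e> = Q psi" by auto
  show thesis by (rule that[OF psi(1)]) (simp only: Q[symmetric] psi(2)[symmetric])
qed

lemma injective_linear_preserving_subspace:
  assumes fin: "finite_dimensional H" and U: "vs.subspace U" and f: "lmap f"
    and maps: "\<And>u. u \<in> U \<Longrightarrow> f u \<in> U" and inj: "\<And>u. u \<in> U \<Longrightarrow> f u = 0 \<Longrightarrow> u = 0"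
  shows "f ` U = U"
proof -
  obtain B0 where B0: "finite B0" "vs.span B0 = UNIV"
    using fin unfolding finite_dimensional_def by auto
  obtain B where B: "B \<subseteq> B0" "vs.independent B" "B0 \<subseteq> vs.span B"
    by (rule vs.maximal_independent_subset[of B0])
  have spB: "vs.span B = UNIV"
    using vs.span_minimal[OF B(3) vs.subspace_span] B0(2) by (simp add: top.extremum_unique)
  interpret fd: finite_dimensional_vector_space "scal H" B
    by unfold_locales (use B B0 spB in \<open>auto intro: finite_subset\<close>)
  interpret fdp: finite_dimensional_vector_space_pair_1 "scal H" B "scal H"
    by unfold_locales
  have "inj_on f (vs.span U)"
  proof (rule inj_onI)
    fix u v assume uv: "u \<in> vs.span U" "v \<in> vs.span U" "f u = f v"
    then have "u - v \<in> U" using U vs.subspace_diff vs.span_eq_iff by metis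
    moreover have "f (u - v) = 0" using lmapD(5)[OF f, of u v] uv(3) by simp
    ultimately show "u = v" using inj[of "u - v"] by simp
  qed
  then have dim: "vs.dim (f ` U) = vs.dim U" by (rule fdp.dim_image_eq[OF f])
  have "vs.subspace (f ` U)" using fdp.linear_subspace_image[OF f U] .
  then show ?thesis
    by (rule fd.subspace_dim_equal[OF _ U]) (use maps dim in auto)
qed

lemma subspace_Hs: "vs.subspace Hs"
  unfolding vs.subspace_def Hs_iff lmapD[OF es_lmap] by (simp add: es_Hs)

end

locale nondegenerate_integral = involutive_weak_hopf_algebra H
  for H :: "('k::field, 'h::ring) weak_hopf" +
  fixes l :: 'h
  assumes fin: "finite_dimensional H" and l: "l \<in> left_integrals H" and nd: "nondegenerate H l"
begin

text \<open>The functional \<open>\<psi>\<close> recovers \<open>h = \<psi>(l\<^sub>1) h l\<^sub>2 = \<psi>(S(h) l\<^sub>1) l\<^sub>2\<close> from \<open>S(h)\<close>.\<close>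

lemma S_inj: assumes "S h = 0" shows "h = 0"
proof (rule vector_eqI)
  fix f assume f: "lform f"
  obtain psi where psi: "lform psi" "\<And>f. lform f \<Longrightarrow> sw l (\<lambda>a b. psi a * f b) = f \<e>"
    by (rule dual_functional_left[OF nd]) blast
  have "f h = f (h * \<e>)" by (simp only: unit_right)
  also have "\<dots> = sw l (\<lambda>a b. psi a * f (h * b))"
    by (rule psi(2)[symmetric]) (intro lin_intros lform_comp[OF f])
  also have "\<dots> = sw l (\<lambda>a b. psi (S h * a) * f b)"
    by (rule left_integral_shift[OF l]) (intro lin_intros lform_comp[OF f] lform_comp[OF psi(1)])
  also have "\<dots> = 0" using sw_zero by (simp add: assms lformD(3)[OF psi(1)])
  finally show "f h = f 0" by (simp add: lformD(3)[OF f])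
qed

lemma S_surj: "\<exists>k. S k = h"
  using injective_linear_preserving_subspace[OF fin vs.subspace_UNIV antipode_linear] S_inj
  by (metis UNIV_I imageE)

lemma integral_mult_Hs_inj:
  assumes y: "y \<in> Hs" and 0: "l * y = 0" shows "y = 0"
proof (rule vector_eqI)
  fix f assume f: "lform f"
  obtain psi where psi: "lform psi" "\<And>f. lform f \<Longrightarrow> sw l (\<lambda>a b. psi a * f b) = f \<e>"
    by (rule dual_functional_left[OF nd]) blast
  have bilin: "bilin (\<lambda>a b. psi a * f b)" by (intro lin_intros lform_comp[OF f] lform_comp[OF psi(1)])
  have "f (\<e> * y) = sw l (\<lambda>a b. psi a * f (b * y))"
    by (rule psi(2)[symmetric]) (intro lin_intros lform_comp[OF f])
  also have "\<dots> = sw (l * y) (\<lambda>a b. psi a * f b)"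
    by (rule sw_Hs_mult_right[OF y bilin, symmetric])
  also have "\<dots> = 0" unfolding 0 using lformD(3)[OF lform_sw[OF bilin]] .
  finally show "f y = f 0" by (simp add: lformD(3)[OF f] unit_left)
qed

lemma integral_mult_Ht_inj:
  assumes x: "x \<in> Ht" and 0: "l * x = 0" shows "x = 0"
proof (rule vector_eqI)
  fix f assume f: "lform f"
  obtain phi where phi: "lform phi" "\<And>f. lform f \<Longrightarrow> sw l (\<lambda>a b. f a * phi b) = f \<e>"
    by (rule dual_functional_right[OF nd]) blast
  have bilin: "bilin (\<lambda>a b. f a * phi b)" by (intro lin_intros lform_comp[OF f] lform_comp[OF phi(1)])
  have "f (\<e> * x) = sw l (\<lambda>a b. f (a * x) * phi b)"
    by (rule phi(2)[symmetric]) (intro lin_intros lform_comp[OF f])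
  also have "\<dots> = sw (l * x) (\<lambda>a b. f a * phi b)"
    by (rule sw_Ht_mult_right[OF x bilin, symmetric])
  also have "\<dots> = 0" unfolding 0 using lformD(3)[OF lform_sw[OF bilin]] .
  finally show "f x = f 0" by (simp add: lformD(3)[OF f] unit_left)
qed

text \<open>
  The functional \<open>\<phi>\<close> is a Frobenius form: every functional is \<open>\<phi>(k -)\<close> for some \<open>k\<close>.  Indeed \<open>\<phi>(k -)\<close>
  corresponds to \<open>l\<^sub>1 \<phi>(k l\<^sub>2) = S(k) l\<^sub>1 \<phi>(l\<^sub>2) = S(k)\<close>, and the antipode is surjective.
\<close>

lemma frobenius_functional_kernel:
  assumes phi: "lform phi" "\<And>f. lform f \<Longrightarrow> sw l (\<lambda>a b. f a * phi b) = f \<e>"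
    and 0: "\<And>h. phi (h * t) = 0"
  shows "t = 0"
proof (rule vector_eqI)
  fix f assume f: "lform f"
  obtain k where k: "S k = sw l (\<lambda>a b. f b \<cdot> a)" using S_surj by blast
  have "(\<lambda>h. f h - phi (k * h)) = (\<lambda>_. 0)"
  proof (rule nondegenerateD(2)[OF nd])
    show "lform (\<lambda>h. f h - phi (k * h))"
      unfolding lform_iff distrib_left mult_scal_right lformD[OF f] lformD[OF phi(1)] by (auto simp: right_diff_distrib)
    fix g assume g: "lform g"
    have "sw l (\<lambda>a b. g a * phi (k * b)) = sw l (\<lambda>a b. g (S k * a) * phi b)"
      by (rule left_integral_shift[OF l]) (intro lin_intros lform_comp[OF g] lform_comp[OF phi(1)])
    also have "\<dots> = g (S k * \<e>)"
      by (rule phi(2)) (intro lin_intros lform_comp[OF g])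
    also have "\<dots> = sw l (\<lambda>a b. g a * f b)"
      unfolding unit_right k by (simp only: lformD[OF g] mult.commute)
    finally show "sw l (\<lambda>a b. g a * (f b - phi (k * b))) = 0"
      unfolding right_diff_distrib sw_diff_fun by simp
  qed
  from fun_cong[OF this, of t] show "f t = f 0" by (simp add: 0 lformD(3)[OF f])
qed

text \<open>
  A left integral \<open>t\<close> is determined by the values \<open>\<phi>(h t) = \<phi>(\<epsilon>\<^sub>t(h) t)\<close>, hence by the values
  \<open>\<phi>(x t)\<close> with \<open>x \<in> H\<^sub>t\<close>, which are recorded by \<open>1\<^sub>1 \<phi>(1\<^sub>2 t) \<in> H\<^sub>s\<close>.
\<close>

lemma left_integrals_embed:
  obtains theta where "lmap theta" "\<And>t. theta t \<in> Hs"
    "\<And>t. t \<in> left_integrals H \<Longrightarrow> theta t = 0 \<Longrightarrow> t = 0"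
proof -
  obtain phi where phi: "lform phi" "\<And>f. lform f \<Longrightarrow> sw l (\<lambda>a b. f a * phi b) = f \<e>"
    by (rule dual_functional_right[OF nd]) blast
  define theta where "theta t = sw \<e> (\<lambda>a b. phi (b * t) \<cdot> a)" for t
  have lin: "lmap theta"
    unfolding theta_def[abs_def] by (intro lmap_sw_body lmap_scale lin_intros lform_comp[OF phi(1)])
  have Hs: "theta t \<in> Hs" for t
    unfolding theta_def by (rule sw_one_in_Hs) (intro lin_intros lform_comp[OF phi(1)])
  have "t = 0" if t: "t \<in> left_integrals H" and 0: "theta t = 0" for t
  proof (rule frobenius_functional_kernel[OF phi])
    fix h
    have "phi (h * t) = phi (ebt (et h) * t)"
      using t unfolding left_integral_iff by (metis ebt_Ht[OF et_in])
    also have "\<dots> = sw \<e> (\<lambda>a b. \<epsilon> (et h * a) * phi (b * t))"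
      by (rule ebt_f) (intro lin_intros lform_comp[OF phi(1)])
    also have "\<dots> = \<epsilon> (et h * theta t)"
      unfolding theta_def by (simp only: push mult_scal_right eps_lin mult.commute)
    also have "\<dots> = 0" by (simp add: 0 eps_lin)
    finally show "phi (h * t) = 0" .
  qed
  then show thesis using that lin Hs by blast
qed

text \<open>
  Left integrals embed into \<open>H\<^sub>s\<close>, and \<open>H\<^sub>s\<close> embeds into left integrals by \<open>y \<mapsto> l y\<close>.  In finite
  dimension both embeddings are onto.  The same holds for \<open>y \<mapsto> l S(y)\<close>, so that each left integral is
  also \<open>l x\<close> with \<open>x \<in> H\<^sub>t\<close>.
\<close>

lemma left_integral_eq_mult_Hs:
  assumes t: "t \<in> left_integrals H" shows "\<exists>y\<in>Hs. t = l * y"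
proof -
  obtain theta where th: "lmap theta" "\<And>t. theta t \<in> Hs"
    "\<And>t. t \<in> left_integrals H \<Longrightarrow> theta t = 0 \<Longrightarrow> t = 0"
    by (rule left_integrals_embed) blast
  have "(\<lambda>y. theta (l * y)) ` Hs = Hs"
  proof (rule injective_linear_preserving_subspace[OF fin subspace_Hs])
    show "lmap (\<lambda>y. theta (l * y))" by (rule lmap_comp[OF th(1)]) (intro lin_intros)
    show "y \<in> Hs \<Longrightarrow> theta (l * y) = 0 \<Longrightarrow> y = 0" for y
      using th(3)[OF left_integral_mult[OF l]] integral_mult_Hs_inj by blast
  qed (rule th(2))
  then obtain y where y: "y \<in> Hs" "theta (l * y) = theta t"
    using th(2)[of t] by (metis (no_types, lifting) imageE)
  have "theta (t - l * y) = 0" using lmapD(5)[OF th(1)] y(2) by simp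
  then have "t - l * y = 0" by (rule th(3)[OF left_integral_diff[OF t left_integral_mult[OF l]]])
  then show ?thesis using y(1) by auto
qed

lemma left_integral_eq_mult_Ht:
  assumes t: "t \<in> left_integrals H" shows "\<exists>x\<in>Ht. t = l * x"
proof -
  obtain theta where th: "lmap theta" "\<And>t. theta t \<in> Hs"
    "\<And>t. t \<in> left_integrals H \<Longrightarrow> theta t = 0 \<Longrightarrow> t = 0"
    by (rule left_integrals_embed) blast
  have "(\<lambda>y. theta (l * S y)) ` Hs = Hs"
  proof (rule injective_linear_preserving_subspace[OF fin subspace_Hs])
    show "lmap (\<lambda>y. theta (l * S y))" by (rule lmap_comp[OF th(1)]) (intro lin_intros)
    show "y \<in> Hs \<Longrightarrow> theta (l * S y) = 0 \<Longrightarrow> y = 0" for y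
      using th(3)[OF left_integral_mult[OF l]] integral_mult_Ht_inj[OF S_Hs_in] S_inj by blast
  qed (rule th(2))
  then obtain y where y: "y \<in> Hs" "theta (l * S y) = theta t"
    using th(2)[of t] by (metis (no_types, lifting) imageE)
  have "theta (t - l * S y) = 0" using lmapD(5)[OF th(1)] y(2) by simp
  then have "t - l * S y = 0" by (rule th(3)[OF left_integral_diff[OF t left_integral_mult[OF l]]])
  then show ?thesis using S_Hs_in[OF y(1)] by auto
qed

end

section \<open>The symmetric separability idempotent of the source base\<close>

context involutive_weak_hopf_algebra begin

text \<open>
  \<open>e = 1\<^sub>1 \<otimes> S(1\<^sub>2)\<close> satisfies \<open>z e\<^sub>1 \<otimes> e\<^sub>2 = e\<^sub>1 \<otimes> e\<^sub>2 z\<close> and \<open>e\<^sub>1 z \<otimes> e\<^sub>2 = e\<^sub>1 \<otimes> z e\<^sub>2\<close> for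
  \<open>z \<in> H\<^sub>s\<close>, and \<open>e\<^sub>1 e\<^sub>2 = e\<^sub>2 e\<^sub>1 = 1\<close>.
\<close>

lemma casimir_left:
  assumes z: "z \<in> Hs" and B: "bilin B"
  shows "sw \<e> (\<lambda>a b. B (z * a) (S b)) = sw \<e> (\<lambda>a b. B a (S b * z))"
proof -
  have "sw \<e> (\<lambda>a b. B (z * a) (S b)) = sw \<e> (\<lambda>a b. B (S (S z) * a) (S b))"
    by (simp only: SS_Hs[OF z])
  also have "\<dots> = sw \<e> (\<lambda>a b. B a (S (S z * b)))"
    by (rule sym, rule trans[OF sw_one_mult_Ht[OF S_Hs_in[OF z]]])
      (intro lin_intros lform_bil1[OF B] lform_bil2[OF B], rule refl)
  also have "\<dots> = sw \<e> (\<lambda>a b. B a (S b * z))"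
    by (rule sw_one_cong) (intro lin_intros lform_bil1[OF B] lform_bil2[OF B], intro lin_intros lform_bil1[OF B] lform_bil2[OF B],
        simp only: S_mult_Ht SS_Hs[OF z])
  finally show ?thesis .
qed

lemma casimir_right:
  assumes z: "z \<in> Hs" and B: "bilin B"
  shows "sw \<e> (\<lambda>a b. B (a * z) (S b)) = sw \<e> (\<lambda>a b. B a (z * S b))"
proof -
  have "sw \<e> (\<lambda>a b. B (a * z) (S b)) = sw \<e> (\<lambda>a b. B a (S (b * S z)))"
    by (rule trans[OF sw_one_mult_Hs[OF z]]) (intro lin_intros lform_bil1[OF B] lform_bil2[OF B], rule refl)
  also have "\<dots> = sw \<e> (\<lambda>a b. B a (z * S b))"
    by (simp only: S_mult_Ht[OF S_Hs_in[OF z]] SS_Hs[OF z])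
  finally show ?thesis .
qed

lemma casimir_mult:
  assumes f: "lform f"
  shows "sw \<e> (\<lambda>a b. f (a * S b)) = f \<e>" "sw \<e> (\<lambda>a b. f (S b * a)) = f \<e>"
proof -
  show 1: "sw \<e> (\<lambda>a b. f (a * S b)) = f \<e>"
    using sw_antipode_right[OF f, of \<e>] by (simp only: et_one)
  have "sw \<e> (\<lambda>a b. f (a * S b)) = sw \<e> (\<lambda>a b. f (S b * a))"
    by (rule sw_one_sym[of "\<lambda>a b. f (a * b)"]) (intro lin_intros lform_comp[OF f])
  then show "sw \<e> (\<lambda>a b. f (S b * a)) = f \<e>" using 1 by simp
qed

text \<open>
  Let \<open>e' = (s \<otimes> s)(e)\<close>, which has the same properties as \<open>e\<close>.  The tensor
  \<open>e\<^sub>1 e'\<^sub>1 \<otimes> e'\<^sub>2 e\<^sub>2\<close> equals \<open>e\<^sub>1 \<otimes> e'\<^sub>2 e'\<^sub>1 e\<^sub>2 = e\<close> when \<open>e'\<^sub>1\<close> is moved through \<open>e\<close>, and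
  equals \<open>e'\<^sub>1 \<otimes> e'\<^sub>2 e\<^sub>1 e\<^sub>2 = e'\<close> when \<open>e\<^sub>1\<close> is moved through \<open>e'\<close>.
\<close>

lemma casimir_automorphism_invariant:
  assumes lin: "lmap s" and Hs: "\<And>y. y \<in> Hs \<Longrightarrow> s y \<in> Hs"
    and surj: "\<And>z. z \<in> Hs \<Longrightarrow> \<exists>y\<in>Hs. s y = z"
    and mult: "\<And>y z. y \<in> Hs \<Longrightarrow> z \<in> Hs \<Longrightarrow> s (y * z) = s y * s z"
    and one: "s \<e> = \<e>" and B: "bilin B"
  shows "sw \<e> (\<lambda>a b. B (s a) (s (S b))) = sw \<e> (\<lambda>a b. B a (S b))"
proof -
  note L = lin_intros lmap_comp[OF lin] lform_bil1[OF B] lform_bil2[OF B]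
  let ?X = "sw \<e> (\<lambda>a b. sw \<e> (\<lambda>c d. B (a * s c) (s (S d) * S b)))"
  have "?X = sw \<e> (\<lambda>c d. sw \<e> (\<lambda>a b. B (a * s c) (s (S d) * S b)))"
    by (rule sw_swap)
  also have "\<dots> = sw \<e> (\<lambda>c d. sw \<e> (\<lambda>a b. B a (s (S d * c) * S b)))"
  proof (rule sw_one_cong)
    fix c d assume c: "c \<in> Hs" and d: "d \<in> Ht"
    have "sw \<e> (\<lambda>a b. B (a * s c) (s (S d) * S b)) = sw \<e> (\<lambda>a b. B a (s (S d) * (s c * S b)))"
      by (rule casimir_right[OF Hs[OF c], where B = "\<lambda>a b. B a (s (S d) * b)"]) (intro L)
    then show "sw \<e> (\<lambda>a b. B (a * s c) (s (S d) * S b)) = sw \<e> (\<lambda>a b. B a (s (S d * c) * S b))"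
      by (simp only: mult[OF S_Ht_in[OF d] c] mult.assoc)
  qed (intro L)+
  also have "\<dots> = sw \<e> (\<lambda>a b. sw \<e> (\<lambda>c d. B a (s (S d * c) * S b)))"
    by (rule sw_swap)
  also have "\<dots> = sw \<e> (\<lambda>a b. B a (s \<e> * S b))"
    by (rule sw_cong[OF refl], rule casimir_mult(2)) (intro L)
  finally have 1: "?X = sw \<e> (\<lambda>a b. B a (S b))" by (simp only: one unit_left)
  have "?X = sw \<e> (\<lambda>a b. sw \<e> (\<lambda>c d. B (s c) (s (S d) * (a * S b))))"
  proof (rule sw_one_cong)
    fix a b assume a: "a \<in> Hs" and b: "b \<in> Ht"
    obtain a' where a': "a' \<in> Hs" "s a' = a" using surj[OF a] by blast
    have "sw \<e> (\<lambda>c d. B (a * s c) (s (S d) * S b)) = sw \<e> (\<lambda>c d. B (s (a' * c)) (s (S d) * S b))"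
      by (rule sw_one_cong) (intro L, intro L, simp only: mult[OF a'(1)] a'(2))
    also have "\<dots> = sw \<e> (\<lambda>c d. B (s c) (s (S d * a') * S b))"
      by (rule casimir_left[OF a'(1), where B = "\<lambda>c d. B (s c) (s d * S b)"]) (intro L)
    also have "\<dots> = sw \<e> (\<lambda>c d. B (s c) (s (S d) * (a * S b)))"
      by (rule sw_one_cong) (intro L, intro L, simp only: mult[OF S_Ht_in a'(1)] a'(2) mult.assoc)
    finally show "sw \<e> (\<lambda>c d. B (a * s c) (s (S d) * S b))
        = sw \<e> (\<lambda>c d. B (s c) (s (S d) * (a * S b)))" .
  qed (intro L)+
  also have "\<dots> = sw \<e> (\<lambda>c d. sw \<e> (\<lambda>a b. B (s c) (s (S d) * (a * S b))))"
    by (rule sw_swap)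
  also have "\<dots> = sw \<e> (\<lambda>c d. B (s c) (s (S d) * \<e>))"
    by (rule sw_cong[OF refl], rule casimir_mult(1)) (intro L)
  finally show ?thesis using 1 by (simp only: unit_right)
qed

end

section \<open>The group-like element of a non-degenerate integral\<close>

context nondegenerate_integral begin

definition proj :: "'h \<Rightarrow> 'h" where "proj h = (THE z. z \<in> Hs \<and> l * h = l * z)"

lemma integral_mult_Hs_eq:
  assumes "y \<in> Hs" "z \<in> Hs" "l * y = l * z" shows "y = z"
proof -
  have "y - z \<in> Hs" by (rule vs.subspace_diff[OF subspace_Hs assms(1,2)])
  moreover have "l * (y - z) = 0" using assms(3) by (simp add: right_diff_distrib)
  ultimately show ?thesis using integral_mult_Hs_inj by fastforce
qed

lemma proj_ex1: "\<exists>!z. z \<in> Hs \<and> l * h = l * z"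
  using left_integral_eq_mult_Hs[OF left_integral_mult[OF l]] integral_mult_Hs_eq by metis

lemma proj_in: "proj h \<in> Hs" and l_proj: "l * h = l * proj h"
  using theI'[OF proj_ex1, of h] unfolding proj_def by auto

lemma proj_eqI: "z \<in> Hs \<Longrightarrow> l * h = l * z \<Longrightarrow> proj h = z"
  using integral_mult_Hs_eq[OF proj_in] l_proj by simp

lemma l_proj_mult: "l * (proj h * k) = l * (h * k)"
  by (metis l_proj mult.assoc)

lemma proj_cong: "l * h = l * k \<Longrightarrow> proj h = proj k"
  unfolding proj_def by simp

lemma proj_Hs: "y \<in> Hs \<Longrightarrow> proj y = y" by (rule proj_eqI) simp_all

lemma proj_proj_mult: "proj (proj h * k) = proj (h * k)"
  by (rule proj_cong[OF l_proj_mult])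

lemma proj_lmap: "lmap proj"
  unfolding lmap_iff
proof (intro conjI allI)
  fix x y c
  show "proj (x + y) = proj x + proj y"
    by (rule proj_eqI) (simp_all add: vs.subspace_add[OF subspace_Hs] proj_in distrib_left l_proj[symmetric])
  show "proj (c \<cdot> x) = c \<cdot> proj x"
    by (rule proj_eqI) (simp_all add: vs.subspace_scale[OF subspace_Hs] proj_in mult_scal_right l_proj[symmetric])
qed

text \<open>\<open>l h x = l \<pi>(h) x = l x \<pi>(h) = l \<pi>(x) \<pi>(h)\<close>, as the bases commute.\<close>

lemma proj_mult_Ht: assumes x: "x \<in> Ht" shows "proj (h * x) = proj x * proj h"
proof (rule proj_eqI)
  show "proj x * proj h \<in> Hs" by (rule Hs_mult[OF proj_in proj_in])
  have "l * (h * x) = l * (proj h * x)" by (rule l_proj_mult[symmetric])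
  also have "\<dots> = l * (x * proj h)" by (simp only: Ht_Hs_commute[OF x proj_in])
  also have "\<dots> = l * (proj x * proj h)" by (rule l_proj_mult[symmetric])
  finally show "l * (h * x) = l * (proj x * proj h)" .
qed

lemma proj_Ht_surj: assumes z: "z \<in> Hs" obtains x where "x \<in> Ht" "proj x = z"
proof -
  obtain x where x: "x \<in> Ht" "l * z = l * x"
    using left_integral_eq_mult_Ht[OF left_integral_mult[OF l]] by blast
  show thesis by (rule that[OF x(1) proj_eqI[OF z x(2)[symmetric]]])
qed

lemma proj_Ht_inj: assumes x: "x \<in> Ht" "x' \<in> Ht" and eq: "proj x = proj x'" shows "x = x'"
proof -
  have "x - x' \<in> Ht" using x by (simp add: Ht_iff lmapD[OF et_lmap])
  moreover have "l * (x - x') = 0" using l_proj[of x] l_proj[of x'] eq by (simp add: right_diff_distrib)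
  ultimately show ?thesis using integral_mult_Ht_inj by fastforce
qed

text \<open>
  An algebra automorphism of \<open>H\<^sub>s\<close>, as both \<open>S\<close> and the restriction of \<open>proj\<close> to \<open>H\<^sub>t\<close> are
  bijective and reverse products.
\<close>

definition sigma :: "'h \<Rightarrow> 'h" where "sigma y = proj (S y)"

lemma sigma_lmap: "lmap sigma"
  unfolding sigma_def[abs_def] by (rule lmap_comp[OF proj_lmap antipode_linear])

lemma sigma_S: "x \<in> Ht \<Longrightarrow> sigma (S x) = proj x"
  unfolding sigma_def by (simp only: SS_Ht)

lemma sigma_one: "sigma \<e> = \<e>"
  unfolding sigma_def S_one by (rule proj_Hs[OF one_Hs])

lemma sigma_inj: "y \<in> Hs \<Longrightarrow> z \<in> Hs \<Longrightarrow> sigma y = sigma z \<Longrightarrow> y = z"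
  unfolding sigma_def using proj_Ht_inj S_Hs_in SS_Hs by metis

lemma sigma_casimir:
  assumes B: "bilin B"
  shows "sw \<e> (\<lambda>a b. B (sigma a) (sigma (S b))) = sw \<e> (\<lambda>a b. B a (S b))"
proof (rule casimir_automorphism_invariant[OF sigma_lmap _ _ _ sigma_one B])
  show "sigma y \<in> Hs" for y unfolding sigma_def by (rule proj_in)
  show "\<exists>y\<in>Hs. sigma y = z" if z: "z \<in> Hs" for z
  proof -
    obtain x where "x \<in> Ht" "proj x = z" by (rule proj_Ht_surj[OF z])
    then show ?thesis using sigma_S S_Ht_in by blast
  qed
  show "sigma (y * z) = sigma y * sigma z" if "y \<in> Hs" "z \<in> Hs" for y z
    unfolding sigma_def S_mult_Hs[OF \<open>y \<in> Hs\<close>] by (rule proj_mult_Ht[OF S_Hs_in[OF \<open>y \<in> Hs\<close>]])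
qed

text \<open>
  The form \<open>\<epsilon>\<close> is recovered from \<open>e = 1\<^sub>1 \<otimes> S(1\<^sub>2)\<close> as the only functional on \<open>H\<^sub>s\<close> with \<open>\<epsilon>(e\<^sub>1) e\<^sub>2 = 1\<close>;
  invariance of \<open>e\<close> shows that \<open>\<epsilon> \<circ> \<sigma>\<close> has the same property.
\<close>

lemma eps_sigma: assumes y: "y \<in> Hs" shows "\<epsilon> (sigma y) = \<epsilon> y"
proof -
  define w where "w = sw \<e> (\<lambda>a b. \<epsilon> (sigma a) \<cdot> b)"
  have w: "w \<in> Ht" unfolding w_def by (rule sw_one_in_Ht) (intro lin_intros lmap_comp[OF sigma_lmap])
  have "sigma (S w) = \<e>"
  proof (rule vector_eqI)
    fix f assume f: "lform f"
    have "f (sigma (S w)) = sw \<e> (\<lambda>a b. \<epsilon> (sigma a) * f (sigma (S b)))"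
      unfolding w_def by (simp only: lmapD[OF antipode_linear] lmapD[OF sigma_lmap] lformD[OF f])
    also have "\<dots> = sw \<e> (\<lambda>a b. \<epsilon> a * f (S b))"
      by (rule sigma_casimir) (intro lin_intros lform_comp[OF f])
    also have "\<dots> = f (S \<e>)"
      by (rule sw_counit_left) (intro lin_intros lform_comp[OF f])
    finally show "f (sigma (S w)) = f \<e>" by (simp only: S_one)
  qed
  then have Sw: "S w = \<e>" using sigma_inj[OF S_Ht_in[OF w] one_Hs] sigma_one by simp
  have "\<epsilon> (sigma y) = sw \<e> (\<lambda>a b. \<epsilon> (a * y) * \<epsilon> (sigma (S b)))"
    by (rule Hs_reproducing(2)[OF y, symmetric]) (intro lin_intros lmap_comp[OF sigma_lmap])
  also have "\<dots> = sw \<e> (\<lambda>a b. \<epsilon> (S b * y) * \<epsilon> (sigma a))"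
    by (rule sw_one_sym[where B = "\<lambda>a b. \<epsilon> (a * y) * \<epsilon> (sigma b)"]) (intro lin_intros lmap_comp[OF sigma_lmap])
  also have "\<dots> = \<epsilon> (S w * y)"
    unfolding w_def by (simp only: lmapD[OF antipode_linear] eps_lin push mult_scal_left mult.commute)
  finally show ?thesis by (simp only: Sw unit_left)
qed

definition alpha :: "'h \<Rightarrow> 'k" where "alpha h = \<epsilon> (proj h)"

lemma alpha_lform: "lform alpha"
  unfolding alpha_def[abs_def] by (rule lform_comp[OF counit_linear proj_lmap])

lemma alpha_Hs: "y \<in> Hs \<Longrightarrow> alpha y = \<epsilon> y"
  unfolding alpha_def by (simp only: proj_Hs)

lemma alpha_Ht: assumes x: "x \<in> Ht" shows "alpha x = \<epsilon> x"
  unfolding alpha_def sigma_S[OF x, symmetric] eps_sigma[OF S_Ht_in[OF x]] by (rule eps_S)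

lemma alpha_mult_Hs: assumes y: "y \<in> Hs" shows "alpha (h * y) = \<epsilon> (proj h * y)"
proof -
  have "proj (h * y) = proj h * y"
    by (rule proj_eqI[OF Hs_mult[OF proj_in y]]) (simp only: l_proj_mult)
  then show ?thesis unfolding alpha_def by simp
qed

lemma alpha_proj_mult: "alpha (proj h * k) = alpha (h * k)"
  unfolding alpha_def by (simp only: proj_proj_mult)

lemma proj_eq_alpha_sum:
  assumes f: "lform f" shows "sw \<e> (\<lambda>a b. alpha (h * a) * f (S b)) = f (proj h)"
proof -
  have "sw \<e> (\<lambda>a b. alpha (h * a) * f (S b)) = sw \<e> (\<lambda>a b. \<epsilon> (proj h * a) * f (S b))"
    by (rule sw_one_cong) (intro lin_intros lform_comp[OF f] lform_comp[OF alpha_lform], intro lin_intros lform_comp[OF f],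
        simp only: alpha_mult_Hs)
  also have "\<dots> = f (proj h)" by (rule Hs_reproducing(1)[OF proj_in f])
  finally show ?thesis .
qed

text \<open>
  The two halves of group-likeness.  The first is \<open>\<alpha>(h k) = \<alpha>(\<pi>(h) k)\<close> with \<open>\<pi>(h)\<close> expanded in dual
  bases.  In the second, \<open>1\<^sub>1 \<otimes> 1\<^sub>2\<close> enters through \<open>\<sigma>(1\<^sub>1)\<close> and \<open>\<sigma>(S(1\<^sub>2))\<close>, and invariance under \<open>\<sigma>\<close>
  reduces it to the first.
\<close>

lemma alpha_mult_right: "alpha (h * k) = sw \<e> (\<lambda>p q. alpha (h * p) * alpha (S q * k))"
  unfolding alpha_proj_mult[of h, symmetric]
  by (rule sym, rule trans[OF _ proj_eq_alpha_sum[of "\<lambda>v. alpha (v * k)"]])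
    (simp only: alpha_proj_mult, intro lin_intros lform_comp[OF alpha_lform])

lemma alpha_mult_left': "alpha (h * k) = sw \<e> (\<lambda>p q. alpha (h * S p) * alpha (q * k))"
proof -
  note L = lin_intros lform_comp[OF alpha_lform] lmap_comp[OF sigma_lmap] lmap_comp[OF proj_lmap]
  have "sw \<e> (\<lambda>p q. alpha (h * S p) * alpha (q * k))
      = sw \<e> (\<lambda>p q. \<epsilon> (sigma p * proj h) * alpha (sigma (S q) * k))"
  proof (rule sw_one_cong)
    fix p q assume p: "p \<in> Hs" and q: "q \<in> Ht"
    have "alpha (h * S p) = \<epsilon> (sigma p * proj h)"
      unfolding alpha_def sigma_def by (simp only: proj_mult_Ht[OF S_Hs_in[OF p]])
    moreover have "alpha (q * k) = alpha (sigma (S q) * k)"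
      by (simp only: sigma_S[OF q] alpha_proj_mult)
    ultimately show "alpha (h * S p) * alpha (q * k) = \<epsilon> (sigma p * proj h) * alpha (sigma (S q) * k)"
      by simp
  qed (intro L)+
  also have "\<dots> = sw \<e> (\<lambda>p q. \<epsilon> (p * proj h) * alpha (S q * k))"
    by (rule sigma_casimir[where B = "\<lambda>u v. \<epsilon> (u * proj h) * alpha (v * k)"]) (intro L)
  also have "\<dots> = alpha (proj h * k)"
    by (rule Hs_reproducing(2)[OF proj_in]) (intro L)
  finally show ?thesis by (simp only: alpha_proj_mult)
qed

lemma alpha_mult_left: "alpha (h * k) = sw \<e> (\<lambda>p q. alpha (h * q) * alpha (S p * k))"
proof -
  note L = lin_intros lform_comp[OF alpha_lform]
  have "alpha (h * k) = sw \<e> (\<lambda>p q. alpha (h * S p) * alpha (S (S q) * k))"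
    by (rule trans[OF alpha_mult_left' sw_one_cong]) (intro L, intro L, simp only: SS_Ht)
  also have "\<dots> = sw \<e> (\<lambda>p q. alpha (h * q) * alpha (S p * k))"
    by (rule sw_one_flip[symmetric, where B = "\<lambda>p q. alpha (h * q) * alpha (S p * k)"]) (intro L)
  finally show ?thesis .
qed

text \<open>
  \<open>\<alpha>(h\<^sub>1) \<alpha>(S(h\<^sub>2)) = \<alpha>(h\<^sub>1 S(h\<^sub>2))\<close> because the copy of \<open>\<Delta>(1)\<close> that comes with the product formula is
  absorbed by \<open>\<Delta>(h)\<close>.  The right-hand side is \<open>\<alpha>(\<epsilon>\<^sub>t(h)) = \<epsilon>(h)\<close>, as \<open>\<alpha>\<close> agrees with \<open>\<epsilon>\<close> on both bases.
\<close>

lemma alpha_inverse: "dual_inverse H alpha (\<lambda>h. alpha (S h))"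
  unfolding dual_inverse_def dual_space_iff
proof (intro conjI ext)
  note L = lin_intros lform_comp[OF alpha_lform]
  show "lform alpha" by (rule alpha_lform)
  show "lform (\<lambda>h. alpha (S h))" by (intro L)
  fix h
  have "sw h (\<lambda>a b. alpha a * alpha (S b)) = sw (h * \<e>) (\<lambda>a b. alpha a * alpha (S b))"
    by (simp only: unit_right)
  also have "\<dots> = sw h (\<lambda>a b. sw \<e> (\<lambda>p q. alpha (a * p) * alpha (S (b * q))))"
    by (rule sw_mult) (intro L)
  also have "\<dots> = sw h (\<lambda>a b. sw \<e> (\<lambda>p q. alpha (a * p) * alpha (S q * S b)))"
    by (rule sw_cong[OF refl], rule sw_one_cong) (intro L, intro L, simp only: S_mult_Ht)
  also have "\<dots> = sw h (\<lambda>a b. alpha (a * S b))"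
    by (simp only: alpha_mult_right[symmetric])
  also have "\<dots> = alpha (et h)" by (rule sw_antipode_right[OF alpha_lform])
  also have "\<dots> = \<epsilon> (\<e> * et h)" by (simp only: alpha_Ht[OF et_in] unit_left)
  also have "\<dots> = \<epsilon> h" by (simp only: eps_et) (simp only: unit_left)
  finally show "dual_mult H alpha (\<lambda>h. alpha (S h)) h = \<epsilon> h" unfolding dual_mult_sw .
  have "sw h (\<lambda>a b. alpha (S a) * alpha b) = sw (\<e> * h) (\<lambda>a b. alpha (S a) * alpha b)"
    by (simp only: unit_left)
  also have "\<dots> = sw \<e> (\<lambda>p q. sw h (\<lambda>a b. alpha (S (p * a)) * alpha (q * b)))"
    by (rule sw_mult) (intro L)
  also have "\<dots> = sw \<e> (\<lambda>p q. sw h (\<lambda>a b. alpha (S a * S p) * alpha (q * b)))"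
    by (rule sw_one_cong) (intro L, intro L, simp only: S_mult_Hs)
  also have "\<dots> = sw h (\<lambda>a b. sw \<e> (\<lambda>p q. alpha (S a * S p) * alpha (q * b)))"
    by (rule sw_swap)
  also have "\<dots> = sw h (\<lambda>a b. alpha (S a * b))"
    by (simp only: alpha_mult_left'[symmetric])
  also have "\<dots> = alpha (es h)" by (rule sw_antipode_left[OF alpha_lform])
  also have "\<dots> = \<epsilon> (es h * \<e>)" by (simp only: alpha_Hs[OF es_in] unit_right)
  also have "\<dots> = \<epsilon> h" by (simp only: eps_es) (simp only: unit_right)
  finally show "dual_mult H (\<lambda>h. alpha (S h)) alpha h = \<epsilon> h" unfolding dual_mult_sw .
qed

lemma alpha_grouplike: "dual_grouplike H alpha"
  unfolding dual_grouplike_def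
proof (intro conjI ext)
  show "\<exists>\<gamma>'. dual_inverse H alpha \<gamma>'" using alpha_inverse by blast
  fix h k
  show "dual_comult alpha h k = dual_tensor_mult H (dual_tensor alpha alpha) (dual_comult \<epsilon>) h k"
    unfolding dual_tensor_mult_sw dual_tensor_def dual_comult_def conv_tensor_right[OF alpha_lform alpha_lform]
    by (rule alpha_mult_right)
  show "dual_comult alpha h k = dual_tensor_mult H (dual_comult \<epsilon>) (dual_tensor alpha alpha) h k"
    unfolding dual_tensor_mult_sw dual_tensor_def dual_comult_def conv_tensor_left[OF alpha_lform alpha_lform]
    by (rule alpha_mult_left)
qed

lemma integral_action_eq: "integral_action H l y h = proj (y * h)"
  unfolding integral_action_def proj_def by (simp only: mult.assoc)

end

section \<open>Isomorphisms between the modules\<close>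

context weak_hopf_algebra begin

lemma grouplike_action_sw: "grouplike_action H g y h = sw \<e> (\<lambda>a b. g (y * h * a) \<cdot> S b)"
  unfolding grouplike_action_def sw_def ..

lemma modules_isomorphic_trans:
  assumes "base_s_modules_isomorphic H p q" "base_s_modules_isomorphic H q r"
  shows "base_s_modules_isomorphic H p r"
proof -
  obtain f where f: "bij_betw f Hs Hs" "\<forall>x\<in>Hs. \<forall>y\<in>Hs. f (x + y) = f x + f y"
    "\<forall>c. \<forall>x\<in>Hs. f (c \<cdot> x) = c \<cdot> f x" "\<forall>y\<in>Hs. \<forall>h. f (p y h) = q (f y) h"
    using assms(1) unfolding base_s_modules_isomorphic_def by blast
  obtain g where g: "bij_betw g Hs Hs" "\<forall>x\<in>Hs. \<forall>y\<in>Hs. g (x + y) = g x + g y"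
    "\<forall>c. \<forall>x\<in>Hs. g (c \<cdot> x) = c \<cdot> g x" "\<forall>y\<in>Hs. \<forall>h. g (q y h) = r (g y) h"
    using assms(2) unfolding base_s_modules_isomorphic_def by blast
  have "f y \<in> Hs" if "y \<in> Hs" for y using f(1) that by (rule bij_betwE[THEN bspec])
  then show ?thesis
    unfolding base_s_modules_isomorphic_def using f g bij_betw_trans[OF f(1) g(1)]
    by (intro exI[of _ "g \<circ> f"]) simp
qed

lemma modules_isomorphicI:
  assumes lin: "lmap f" and Hs: "\<And>y. y \<in> Hs \<Longrightarrow> f y \<in> Hs" "\<And>y. y \<in> Hs \<Longrightarrow> g y \<in> Hs"
    and inv: "\<And>y. y \<in> Hs \<Longrightarrow> g (f y) = y" "\<And>y. y \<in> Hs \<Longrightarrow> f (g y) = y"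
    and act: "\<And>y h. y \<in> Hs \<Longrightarrow> f (p y h) = q (f y) h"
  shows "base_s_modules_isomorphic H p q"
  unfolding base_s_modules_isomorphic_def
  by (intro exI[of _ f] conjI ballI allI bij_betw_byWitness[where f' = g] lmapD(1)[OF lin] lmapD(2)[OF lin] act)
    (use Hs inv in auto)

end

context nondegenerate_integral begin

text \<open>
  The module of \<open>h \<mapsto> \<alpha>(x h x')\<close> has the action \<open>y \<cdot> h = \<pi>(x y h x')\<close>, and \<open>y \<mapsto> \<pi>(x' y)\<close>
  carries the action \<open>\<pi>(y h)\<close> to it.  All identities are checked after multiplication by \<open>l\<close>
  from the left, where \<open>\<pi>\<close> disappears and elements of \<open>H\<^sub>t\<close> can be moved past values of \<open>\<pi>\<close>.
\<close>

lemma modules_isomorphic_grouplike: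
  assumes x: "x \<in> Ht" and x': "x' \<in> Ht" and inv: "x * x' = \<e>" "x' * x = \<e>"
  shows "base_s_modules_isomorphic H (integral_action H l) (grouplike_action H (\<lambda>h. alpha (x * h * x')))"
proof -
  note L = lin_intros lmap_comp[OF proj_lmap] lform_comp[OF alpha_lform]
  have act: "grouplike_action H (\<lambda>h. alpha (x * h * x')) y h = proj (x * (y * h) * x')" for y h
  proof (rule vector_eqI)
    fix f assume f: "lform f"
    have "f (grouplike_action H (\<lambda>h. alpha (x * h * x')) y h)
        = sw \<e> (\<lambda>a b. alpha (x * (y * h * a) * x') * f (S b))"
      unfolding grouplike_action_sw by (simp only: lformD[OF f])
    also have "\<dots> = sw \<e> (\<lambda>a b. alpha ((x * (y * h) * x') * a) * f (S b))"
      by (rule sw_one_cong) (intro L lform_comp[OF f], intro L lform_comp[OF f],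
          simp only: mult.assoc Ht_Hs_commute[OF x'])
    also have "\<dots> = f (proj (x * (y * h) * x'))" by (rule proj_eq_alpha_sum[OF f])
    finally show "f (grouplike_action H (\<lambda>h. alpha (x * h * x')) y h) = f (proj (x * (y * h) * x'))" .
  qed
  have swap: "l * (u * (proj v * w)) = l * (v * (u * w))" if "u \<in> Ht" for u v w
    using l_proj_mult[of v "u * w"] Ht_Hs_commute[OF that proj_in[of v]] by (metis mult.assoc)
  have swap1: "l * (u * proj v) = l * (v * u)" if "u \<in> Ht" for u v
    using swap[OF that, of v \<e>] by (simp only: unit_right)
  have cancel: "proj (u * proj (v * y)) = y" if "u \<in> Ht" "v * u = \<e>" "v \<in> Ht" "y \<in> Hs" for u v y
  proof (rule proj_eqI[OF that(4)])
    have "l * (u * proj (v * y)) = l * (v * (y * u))" by (simp only: swap1[OF that(1)] mult.assoc)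
    also have "\<dots> = l * (v * (u * y))" by (simp only: Ht_Hs_commute[OF that(1,4)])
    finally show "l * (u * proj (v * y)) = l * y" by (simp only: inverse_cancel[OF that(2)])
  qed
  show ?thesis
  proof (rule modules_isomorphicI[where f = "\<lambda>y. proj (x' * y)" and g = "\<lambda>y. proj (x * y)"])
    show "lmap (\<lambda>y. proj (x' * y))" by (intro L)
    fix y h assume y: "y \<in> Hs"
    show "proj (x * proj (x' * y)) = y" by (rule cancel[OF x inv(2) x' y])
    show "proj (x' * proj (x * y)) = y" by (rule cancel[OF x' inv(1) x y])
    have "l * (x' * proj (y * h)) = l * (y * (h * x'))" by (simp only: swap1[OF x'] mult.assoc)
    also have "\<dots> = l * (x' * (x * (y * (h * x'))))" by (simp only: inverse_cancel[OF inv(2)])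
    also have "\<dots> = l * (x' * (y * (x * (h * x'))))"
      using Ht_Hs_commute[OF x y] by (metis mult.assoc)
    also have "\<dots> = l * (x * (proj (x' * y) * (h * x')))"
      by (simp only: swap[OF x] mult.assoc)
    finally show "proj (x' * integral_action H l y h)
        = grouplike_action H (\<lambda>h. alpha (x * h * x')) (proj (x' * y)) h"
      unfolding act integral_action_eq by (intro proj_cong) (simp only: mult.assoc)
  qed (rule proj_in)+
qed

text \<open>
  For \<open>h \<in> H\<^sub>s\<close> both actions are right multiplication (for \<open>g\<close> this is \<open>grouplike_on_Hs\<close>), so the
  isomorphism is left multiplication by its value \<open>u\<close> at \<open>1\<close>.  Applying \<open>\<epsilon>\<close> to
  \<open>u \<pi>(h) = \<pi>\<^sub>g(u h)\<close>, where \<open>\<pi>\<^sub>g\<close> is the projection with \<open>\<epsilon> \<circ> \<pi>\<^sub>g = g\<close>, gives \<open>g\<close> in terms of \<open>\<pi>\<close>.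
\<close>

lemma modules_isomorphic_grouplike_imp:
  assumes g: "dual_grouplike H g"
    and iso: "base_s_modules_isomorphic H (integral_action H l) (grouplike_action H g)"
  shows "\<exists>x\<in>Ht. \<exists>x'\<in>Ht. x * x' = \<e> \<and> x' * x = \<e> \<and> g = (\<lambda>h. alpha (x * h * x'))"
proof -
  have lg: "lform g" using g unfolding dual_grouplike_def dual_inverse_def dual_space_iff by blast
  define pg where "pg k = sw \<e> (\<lambda>a b. g (k * a) \<cdot> S b)" for k
  have pg_f: "f (pg k) = sw \<e> (\<lambda>a b. g (k * a) * f (S b))" if "lform f" for f k
    unfolding pg_def by (simp only: lformD[OF that])
  have pg_Hs: "pg z = z" if z: "z \<in> Hs" for z
  proof (rule vector_eqI)
    fix f assume f: "lform f"
    have "f (pg z) = sw \<e> (\<lambda>a b. \<epsilon> (z * a) * f (S b))"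
      unfolding pg_f[OF f]
      by (rule sw_one_cong) (intro lin_intros lform_comp[OF f] lform_comp[OF lg], intro lin_intros lform_comp[OF f],
          simp only: grouplike_on_Hs[OF g Hs_mult[OF z]])
    then show "f (pg z) = f z" by (simp only: Hs_reproducing(1)[OF z f])
  qed
  have eps_pg: "\<epsilon> (pg k) = g k" for k
  proof -
    have "\<epsilon> (pg k) = sw \<e> (\<lambda>a b. g (k * a) * \<epsilon> b)" by (simp only: pg_f[OF counit_linear] eps_S)
    also have "\<dots> = g (k * \<e>)" by (rule sw_counit_right) (intro lin_intros lform_comp[OF lg])
    finally show ?thesis by (simp only: unit_right)
  qed
  obtain f where bij: "bij_betw f Hs Hs"
    and act: "\<And>y h. y \<in> Hs \<Longrightarrow> f (integral_action H l y h) = grouplike_action H g (f y) h"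
    using iso unfolding base_s_modules_isomorphic_def by blast
  have f: "f (proj (y * h)) = pg (f y * h)" if "y \<in> Hs" for y h
    using act[OF that, of h] unfolding integral_action_eq grouplike_action_sw pg_def .
  have fHs: "f y \<in> Hs" if "y \<in> Hs" for y using bij that by (rule bij_betwE[THEN bspec])
  define u where "u = f \<e>"
  have u: "u \<in> Hs" unfolding u_def by (rule fHs[OF one_Hs])
  have fz: "f z = u * z" if z: "z \<in> Hs" for z
    using f[OF one_Hs, of z] unfolding u_def unit_left proj_Hs[OF z]
    by (simp only: pg_Hs[OF Hs_mult[OF fHs[OF one_Hs] z]])
  obtain v where v: "v \<in> Hs" "f v = \<e>" using bij one_Hs unfolding bij_betw_def by (metis imageE)
  have uv: "u * v = \<e>" using fz[OF v(1)] v(2) by simp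
  have "f (v * u) = f \<e>"
    using fz[OF Hs_mult[OF v(1) u]] inverse_cancel[OF uv, of u] u_def by simp
  then have vu: "v * u = \<e>"
    using bij Hs_mult[OF v(1) u] one_Hs unfolding bij_betw_def inj_on_def by blast
  have g_eq: "g h = \<epsilon> (u * proj (v * h))" for h
  proof -
    have "u * proj (v * h) = pg (u * (v * h))"
      using f[OF one_Hs, of "v * h"] fz[OF proj_in] unfolding unit_left u_def[symmetric] by simp
    then show ?thesis by (simp only: eps_pg inverse_cancel[OF uv])
  qed
  \<comment> \<open>The factors \<open>u\<close>, \<open>v\<close> lie in \<open>H\<^sub>s\<close>; through \<open>proj\<close> they become inverse elements of \<open>H\<^sub>t\<close>.\<close>
  obtain x where x: "x \<in> Ht" "proj x = v" by (rule proj_Ht_surj[OF v(1)])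
  obtain x' where x': "x' \<in> Ht" "proj x' = u" by (rule proj_Ht_surj[OF u])
  have "proj (x * x') = proj \<e>" "proj (x' * x) = proj \<e>"
    unfolding proj_mult_Ht[OF x(1)] proj_mult_Ht[OF x'(1)] x(2) x'(2) uv vu proj_Hs[OF one_Hs] by simp_all
  then have inv: "x * x' = \<e>" "x' * x = \<e>"
    using proj_Ht_inj[OF Ht_mult[OF x(1) x'(1)] one_Ht] proj_Ht_inj[OF Ht_mult[OF x'(1) x(1)] one_Ht] by auto
  have "g = (\<lambda>h. alpha (x * h * x'))"
  proof
    fix h
    have "alpha (x * h * x') = \<epsilon> (u * proj (proj x * h))"
      unfolding alpha_def proj_mult_Ht[OF x'(1)] x'(2) by (simp only: proj_proj_mult)
    then show "g h = alpha (x * h * x')" by (simp only: g_eq x(2))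
  qed
  then show ?thesis using x(1) x'(1) inv by blast
qed

lemma integral_modules_isomorphic:
  assumes l': "l' \<in> left_integrals H" and nd': "nondegenerate H l'"
  shows "base_s_modules_isomorphic H (integral_action H l') (integral_action H l)"
proof -
  interpret l': nondegenerate_integral H l'
    by unfold_locales (rule fin l' nd')+
  obtain u where u: "u \<in> Hs" "l' = l * u" using left_integral_eq_mult_Hs[OF l'] by blast
  obtain v where v: "v \<in> Hs" "l = l' * v" using l'.left_integral_eq_mult_Hs[OF l] by blast
  have uv: "u * v = \<e>"
    by (rule integral_mult_Hs_eq[OF Hs_mult[OF u(1) v(1)] one_Hs]) (metis u(2) v(2) mult.assoc unit_right)
  have vu: "v * u = \<e>"
    by (rule l'.integral_mult_Hs_eq[OF Hs_mult[OF v(1) u(1)] one_Hs]) (metis u(2) v(2) mult.assoc unit_right)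
  show ?thesis
  proof (rule modules_isomorphicI[where f = "\<lambda>y. u * y" and g = "\<lambda>y. v * y"])
    show "lmap (\<lambda>y. u * y)" by (intro lin_intros)
    fix y h assume y: "y \<in> Hs"
    show "u * y \<in> Hs" "v * y \<in> Hs" using Hs_mult u(1) v(1) y by auto
    show "v * (u * y) = y" by (rule inverse_cancel[OF vu])
    show "u * (v * y) = y" by (rule inverse_cancel[OF uv])
    have "l * (u * y * h) = l * (u * l'.proj (y * h))"
      using l'.l_proj[of "y * h"] unfolding u(2) by (simp only: mult.assoc)
    then have "proj (u * y * h) = u * l'.proj (y * h)"
      by (rule proj_eqI[OF Hs_mult[OF u(1) l'.proj_in]])
    then show "u * integral_action H l' y h = integral_action H l (u * y) h"
      unfolding integral_action_eq l'.integral_action_eq by simp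
  qed
qed

end

theorem corollary5p5:
  fixes H :: "('k::field, 'h::ring) weak_hopf"
  assumes "weak_hopf_algebra H"
    and "finite_dimensional H"
    and "frobenius_algebra H"
    and "\<forall>x\<in>min_subalgebra H. antipode H (antipode H x) = x"
  shows "\<exists>\<alpha>t \<in> carrier (grouplike_group H Mod trivial_grouplikes H).
    (\<forall>l\<in>left_integrals H. nondegenerate H l \<longrightarrow>
       (\<forall>\<alpha>\<in>\<alpha>t. base_s_modules_isomorphic H (integral_action H l) (grouplike_action H \<alpha>))) \<and>
    (\<forall>l\<in>left_integrals H. nondegenerate H l \<longrightarrow>
       (\<forall>\<alpha>\<in>carrier (grouplike_group H).
          base_s_modules_isomorphic H (integral_action H l) (grouplike_action H \<alpha>) \<longrightarrow> \<alpha> \<in> \<alpha>t))"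
proof -
  interpret weak_hopf_algebra H by fact
  interpret involutive_weak_hopf_algebra H
  proof unfold_locales
    fix x assume "x \<in> base_t H"
    then have "x * \<e> \<in> min_subalgebra H"
      unfolding min_subalgebra_def using one_Hs by (intro vs.span_base) blast
    then show "S (S x) = x" using assms(4) by (simp add: unit_right)
  next
    fix y assume "y \<in> base_s H"
    then have "\<e> * y \<in> min_subalgebra H"
      unfolding min_subalgebra_def using one_Ht by (intro vs.span_base) blast
    then show "S (S y) = y" using assms(4) by (simp add: unit_left)
  qed
  have coset: "trivial_grouplikes H #>\<^bsub>grouplike_group H\<^esub> a \<in> carrier (grouplike_group H Mod trivial_grouplikes H)"
    if "dual_grouplike H a" for a
    using that unfolding FactGroup_def RCOSETS_def grouplike_group_def by auto
  \<comment> \<open>Without a non-degenerate left integral the claim is vacuous for every coset.\<close>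
  show ?thesis
  proof (cases "\<exists>l\<in>left_integrals H. nondegenerate H l")
    case False
    then show ?thesis using coset[OF counit_grouplike] by blast
  next
    case True
    then obtain l where int_l: "l \<in> left_integrals H" "nondegenerate H l" by blast
    interpret nondegenerate_integral H l
      by unfold_locales (rule assms(2) int_l)+
    define C where "C = trivial_grouplikes H #>\<^bsub>grouplike_group H\<^esub> alpha"
    have mem_C_iff: "a \<in> C \<longleftrightarrow>
      (\<exists>x\<in>Ht. \<exists>x'\<in>Ht. x * x' = \<e> \<and> x' * x = \<e> \<and> a = (\<lambda>h. alpha (x * h * x')))" for a
    proof -
      have "a \<in> C \<longleftrightarrow> (\<exists>d\<in>trivial_grouplikes H. a = dual_mult H d alpha)"
        unfolding C_def r_coset_def grouplike_group_def by auto
      then show ?thesis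
        unfolding Bex_def trivial_grouplikes_iff using twist_mult[OF _ _ alpha_lform] by metis
    qed
    show ?thesis
    proof (intro bexI[of _ C] conjI ballI impI)
      show "C \<in> carrier (grouplike_group H Mod trivial_grouplikes H)"
        unfolding C_def by (rule coset[OF alpha_grouplike])
    next
      fix l' a assume l': "l' \<in> left_integrals H" "nondegenerate H l'" and "a \<in> C"
      then have "base_s_modules_isomorphic H (integral_action H l) (grouplike_action H a)"
        using modules_isomorphic_grouplike unfolding mem_C_iff by blast
      then show "base_s_modules_isomorphic H (integral_action H l') (grouplike_action H a)"
        by (rule modules_isomorphic_trans[OF integral_modules_isomorphic[OF l']])
    next
      fix l' a assume l': "l' \<in> left_integrals H" "nondegenerate H l'"
        and a: "a \<in> carrier (grouplike_group H)"
        and iso: "base_s_modules_isomorphic H (integral_action H l') (grouplike_action H a)"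
      interpret l': nondegenerate_integral H l'
        by unfold_locales (rule assms(2) l')+
      have "base_s_modules_isomorphic H (integral_action H l) (grouplike_action H a)"
        by (rule modules_isomorphic_trans[OF l'.integral_modules_isomorphic[OF int_l] iso])
      moreover have "dual_grouplike H a" using a unfolding grouplike_group_def by simp
      ultimately show "a \<in> C" unfolding mem_C_iff by (intro modules_isomorphic_grouplike_imp)
    qed
  qed
qed

end
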